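(* Let $\pi_{\rm joint}=\exp(-V_{\rm joint})$ be a probability density on $\mathbb{R}^{n_x}\times\mathbb{R}^{n_y}$ ($n_x,n_y\ge 1$) with $V_{\rm joint}\in C^2$ convex, $L(\pi_{\rm joint})<\infty$ and $\psi(\pi_{\rm joint})>0$. Suppose that JointMH (targeting $\pi_{\rm joint}$) and MarCo satisfy the following. (B1) The transition kernel of JointMH and that of the $\mathbf{y}$-marginal chain in MarCo are instances of the same MCMC kernel family, targeting $\pi_{\rm joint}$ and $\pi_{\rm marg}$, respectively. (B2) The initial distribution of JointMH is $\pi_{\rm joint}^0(\mathrm{d}\mathbf{x},\mathrm{d}\mathbf{y})=\pi_{\rm cond}(\mathrm{d}\mathbf{x}\mid\mathbf{y})\,\pi_{\rm marg}^0(\mathrm{d}\mathbf{y})$, and $\pi_{\rm marg}^0$ is the initial distribution of the $\mathbf{y}$-chain in MarCo. Moreover, $\pi_{\rm joint}^0$ is a warm start for $\pi_{\rm joint}$. (B3) For the MCMC family considered there is a hyperparameter tuning map $(\varepsilon,d,\beta(\pi^0),L(\pi),\psi(\pi))\mapsto\{\text{tuned MCMC hyperparameters}\}$, for targets $\pi$ on $\mathbb{R}^d$ and initial distributions $\pi^0$, such that the MCMC method with the tuned hyperparameters has a mixing time upper bound $t_{\rm mix}^\uparrow(\varepsilon;d,\beta(\pi^0),\hat\kappa(\pi))$ that is strictly increasing in $d$ and non-decreasing in $\beta(\pi^0)$ and in $\hat\kappa(\pi)$. Then the mixing time upper bound of MarCo is strictly smaller than that of JointMH: for every threshold $\varepsilon>0$,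 $$t_{\rm mix,\,MarCo}^{\uparrow}(\varepsilon)<t_{\rm mix,\,JointMH}^{\uparrow}(\varepsilon).$$
   Context: Notation. $\pi_{\rm marg}(\mathbf{y})=\int\pi_{\rm joint}(\mathbf{x},\mathbf{y})\,\mathrm{d}\mathbf{x}$ and $\pi_{\rm cond}(\mathbf{x}\mid\mathbf{y})=\pi_{\rm joint}(\mathbf{x},\mathbf{y})/\pi_{\rm marg}(\mathbf{y})$. For a density $\pi=\exp(-V)$ on $\mathbb{R}^d$ with $V\in C^2(\mathbb{R}^d)$ convex, $L(\pi)=\inf\{L\ge 0:\nabla^2V(\mathbf{z})\preceq L\,\mathbf{I}_d\ \forall\mathbf{z}\in\mathbb{R}^d\}$. For nonempty $S_1,S_2\subseteq\mathbb{R}^d$ let $D(S_1,S_2)=\inf_{\mathbf{z}_1\in S_1,\mathbf{z}_2\in S_2}\|\mathbf{z}_1-\mathbf{z}_2\|_2$. The distribution $\pi$ satisfies an isoperimetric inequality with constant $\psi>0$ if $\pi(S_3)\ge\psi\,D(S_1,S_2)\,\pi(S_1)\,\pi(S_2)$ for every measurable partition $(S_1,S_2,S_3)$ of $\mathbb{R}^d$ with $S_1,S_2$ nonempty; $\psi(\pi)$ is the supremum of all such constants ($0$ if there is none). If $\psi(\pi)>0$, $\hat\kappa(\pi)=L(\pi)/\psi(\pi)^2$. Warm start: an initial distribution $\pi^0$ with a density is a ($\beta$-)warm start for $\pi$ if, for some $\beta\ge1$, $\pi^0(\mathbf{z})\le\beta\,\pi(\mathbf{z})$ for almost every $\mathbf{z}$.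 $\beta(\pi^0)=\beta(\pi^0\Vert\pi)$ is the infimum of all such $\beta$. Thus $\beta(\pi_{\rm joint}^0)$ is relative to $\pi_{\rm joint}$ and $\beta(\pi_{\rm marg}^0)$ is relative to $\pi_{\rm marg}$. Mixing time: for a chain with law $\pi^t$ at time $t$ and stationary distribution $\pi$, $t_{\rm mix}(\varepsilon;\pi^0)=\min\{t:\|\pi^t-\pi\|_{\rm TV}\le\varepsilon\}$ with $\|\pi'-\pi\|_{\rm TV}=\sup_A|\pi'(A)-\pi(A)|$; a mixing time upper bound is a (finite) quantity $t_{\rm mix}^\uparrow\ge t_{\rm mix}$. Algorithms. JointMH is a Metropolis--Hastings chain on $\mathbb{R}^{n_x+n_y}$ with target $\pi_{\rm joint}$. MarCo runs a Metropolis--Hastings chain with kernel $k_{\rm marg}$ on $\mathbb{R}^{n_y}$ targeting $\pi_{\rm marg}$ (the $\mathbf{y}$-chain) and draws $\mathbf{x}^t\sim\pi_{\rm cond}(\cdot\mid\mathbf{y}^t)$ exactly; its kernel is $\pi_{\rm cond}(\mathrm{d}\hat{\mathbf{x}}\mid\hat{\mathbf{y}})\,k_{\rm marg}(\mathbf{y},\mathrm{d}\hat{\mathbf{y}})$, and its mixing time to $\pi_{\rm joint}$ equals that of its $\mathbf{y}$-chain to $\pi_{\rm marg}$. Both methods use the tuned hyperparameters from (B3), for the target $\pi_{\rm joint}$ in dimension $n_x+n_y$ and for the target $\pi_{\rm marg}$ in dimension $n_y$, respectively. The mixing time upper bounds being compared are those given by (B3): $$t_{\rm mix,\,JointMH}^\uparrow(\varepsilon)=t_{\rm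 mix}^\uparrow\big(\varepsilon;\,n_x+n_y,\,\beta(\pi_{\rm joint}^0),\,\hat\kappa(\pi_{\rm joint})\big),\qquad t_{\rm mix,\,MarCo}^\uparrow(\varepsilon)=t_{\rm mix}^\uparrow\big(\varepsilon;\,n_y,\,\beta(\pi_{\rm marg}^0),\,\hat\kappa(\pi_{\rm marg})\big).$$ *)

theory Defs
  imports "HOL-Probability.Probability"
begin

text \<open>
  The kernel family and the mixing time bound range over all dimensions, so the dimension
  has to be a natural number rather than a type. A point of \<open>d\<close>-dimensional space is a function
  on the indices below \<open>d\<close>, extended by \<^term>\<open>undefined\<close>; on these points the product topology
  of \<^typ>\<open>nat \<Rightarrow> real\<close> is the Euclidean one.
\<close>

type_synonym point = "nat \<Rightarrow> real"

definition leb :: "nat \<Rightarrow> point measure" where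
  "leb d = PiM {..<d} (\<lambda>_. lborel)"

definition euclid :: "nat \<Rightarrow> point set" where
  "euclid d = PiE {..<d} (\<lambda>_. UNIV)"

definition euclid_dist :: "nat \<Rightarrow> point \<Rightarrow> point \<Rightarrow> real" where
  "euclid_dist d z w = L2_set (\<lambda>i. z i - w i) {..<d}"

text \<open>The point \<open>(x, y)\<close>, and the component \<open>y\<close> of such a point.\<close>

definition joinp :: "nat \<Rightarrow> nat \<Rightarrow> point \<Rightarrow> point \<Rightarrow> point" where
  "joinp nx ny x y = (\<lambda>i\<in>{..<nx + ny}. if i < nx then x i else y (i - nx))"

definition ypart :: "nat \<Rightarrow> nat \<Rightarrow> point \<Rightarrow> point" where
  "ypart nx ny z = (\<lambda>i\<in>{..<ny}. z (nx + i))"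

definition line :: "(point \<Rightarrow> real) \<Rightarrow> nat \<Rightarrow> point \<Rightarrow> real \<Rightarrow> real" where
  "line f i z t = f (z(i := t))"

definition partial :: "nat \<Rightarrow> (point \<Rightarrow> real) \<Rightarrow> point \<Rightarrow> real" where
  "partial i f z = deriv (line f i z) (z i)"

definition C1 :: "nat \<Rightarrow> (point \<Rightarrow> real) \<Rightarrow> bool" where
  "C1 d f \<longleftrightarrow> continuous_on (euclid d) f \<and>
     (\<forall>i<d. (\<forall>z\<in>euclid d. line f i z differentiable (at (z i))) \<and>
            continuous_on (euclid d) (partial i f))"

definition C2 :: "nat \<Rightarrow> (point \<Rightarrow> real) \<Rightarrow> bool" where
  "C2 d f \<longleftrightarrow> C1 d f \<and> (\<forall>i<d. C1 d (partial i f))"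

definition convex_fun :: "nat \<Rightarrow> (point \<Rightarrow> real) \<Rightarrow> bool" where
  "convex_fun d f \<longleftrightarrow>
     (\<forall>z\<in>euclid d. \<forall>w\<in>euclid d. \<forall>t\<in>{0..1}.
        f (\<lambda>i\<in>{..<d}. (1 - t) * z i + t * w i) \<le> (1 - t) * f z + t * f w)"

text \<open>The matrix inequality \<open>\<nabla>\<^sup>2 f(z) \<preceq> c I\<close>.\<close>

definition hessian_le :: "nat \<Rightarrow> (point \<Rightarrow> real) \<Rightarrow> point \<Rightarrow> real \<Rightarrow> bool" where
  "hessian_le d f z c \<longleftrightarrow>
     (\<forall>v :: point. (\<Sum>i<d. \<Sum>j<d. v i * v j * partial i (partial j f) z) \<le> c * (\<Sum>i<d. (v i)\<^sup>2))"

definition prob_density :: "nat \<Rightarrow> (point \<Rightarrow> real) \<Rightarrow> bool" where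
  "prob_density d p \<longleftrightarrow> p \<in> borel_measurable (leb d) \<and> (\<forall>z\<in>euclid d. 0 \<le> p z) \<and>
     (\<integral>\<^sup>+ z. ennreal (p z) \<partial>leb d) = 1"

definition dens_measure :: "nat \<Rightarrow> (point \<Rightarrow> real) \<Rightarrow> point measure" where
  "dens_measure d p = density (leb d) (\<lambda>z. ennreal (p z))"

definition potential :: "(point \<Rightarrow> real) \<Rightarrow> point \<Rightarrow> real" where
  "potential p z = - ln (p z)"

text \<open>Probability densities \<open>exp (- V)\<close> with \<open>V\<close> convex and twice continuously differentiable.\<close>

definition log_concave_density :: "nat \<Rightarrow> (point \<Rightarrow> real) \<Rightarrow> bool" where
  "log_concave_density d p \<longleftrightarrow> prob_density d p \<and> (\<forall>z\<in>euclid d. 0 < p z) \<and>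
     C2 d (potential p) \<and> convex_fun d (potential p)"

definition smoothness :: "nat \<Rightarrow> (point \<Rightarrow> real) \<Rightarrow> ereal" where
  "smoothness d p = Inf {ereal c | c. 0 \<le> c \<and> (\<forall>z\<in>euclid d. hessian_le d (potential p) z c)}"

definition set_distance :: "nat \<Rightarrow> point set \<Rightarrow> point set \<Rightarrow> real" where
  "set_distance d S1 S2 = Inf {euclid_dist d z w | z w. z \<in> S1 \<and> w \<in> S2}"

definition isoperimetric :: "nat \<Rightarrow> (point \<Rightarrow> real) \<Rightarrow> real \<Rightarrow> bool" where
  "isoperimetric d p c \<longleftrightarrow> 0 < c \<and>
     (\<forall>S1\<in>sets (leb d). \<forall>S2\<in>sets (leb d). \<forall>S3\<in>sets (leb d).
        S1 \<union> S2 \<union> S3 = euclid d \<and> S1 \<inter> S2 = {} \<and> S1 \<inter> S3 = {} \<and> S2 \<inter> S3 = {} \<and>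
        S1 \<noteq> {} \<and> S2 \<noteq> {} \<longrightarrow>
        measure (dens_measure d p) S3 \<ge>
          c * set_distance d S1 S2 * measure (dens_measure d p) S1 * measure (dens_measure d p) S2)"

definition isoper_const :: "nat \<Rightarrow> (point \<Rightarrow> real) \<Rightarrow> ereal" where
  "isoper_const d p = Sup (insert 0 {ereal c | c. isoperimetric d p c})"

text \<open>
  For a probability density in dimension at least one the isoperimetric constant is finite (take
  for \<open>S3\<close> a slab separating two half-spaces), so the conversions to \<^typ>\<open>real\<close> below lose nothing
  if the smoothness constant is finite.
\<close>

definition cond_number :: "nat \<Rightarrow> (point \<Rightarrow> real) \<Rightarrow> real" where
  "cond_number d p = real_of_ereal (smoothness d p) / (real_of_ereal (isoper_const d p))\<^sup>2"

definition marg :: "nat \<Rightarrow> nat \<Rightarrow> (point \<Rightarrow> real) \<Rightarrow> point \<Rightarrow> real" where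
  "marg nx ny p y = (\<integral> x. p (joinp nx ny x y) \<partial>leb nx)"

definition cond :: "nat \<Rightarrow> nat \<Rightarrow> (point \<Rightarrow> real) \<Rightarrow> point \<Rightarrow> point \<Rightarrow> real" where
  "cond nx ny p x y = p (joinp nx ny x y) / marg nx ny p y"

text \<open>The distribution \<open>\<pi>_cond(dx | y) \<mu>(dy)\<close> of the pair \<open>(x, y)\<close>.\<close>

definition cond_lift ::
    "nat \<Rightarrow> nat \<Rightarrow> (point \<Rightarrow> real) \<Rightarrow> point measure \<Rightarrow> point measure" where
  "cond_lift nx ny p \<mu> =
     distr (density (leb nx \<Otimes>\<^sub>M \<mu>) (\<lambda>(x, y). ennreal (cond nx ny p x y)))
       (leb (nx + ny)) (\<lambda>(x, y). joinp nx ny x y)"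

definition warm_with :: "nat \<Rightarrow> point measure \<Rightarrow> (point \<Rightarrow> real) \<Rightarrow> real \<Rightarrow> bool" where
  "warm_with d P0 p b \<longleftrightarrow> 1 \<le> b \<and>
     (\<exists>p0. prob_density d p0 \<and> P0 = dens_measure d p0 \<and> (AE z in leb d. p0 z \<le> b * p z))"

definition warm_start :: "nat \<Rightarrow> point measure \<Rightarrow> (point \<Rightarrow> real) \<Rightarrow> bool" where
  "warm_start d P0 p \<longleftrightarrow> (\<exists>b. warm_with d P0 p b)"

definition warmness :: "nat \<Rightarrow> point measure \<Rightarrow> (point \<Rightarrow> real) \<Rightarrow> ereal" where
  "warmness d P0 p = Inf {ereal b | b. warm_with d P0 p b}"

definition law :: "(point \<Rightarrow> point measure) \<Rightarrow> point measure \<Rightarrow> nat \<Rightarrow> point measure" where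
  "law K P0 t = ((\<lambda>\<mu>. \<mu> \<bind> K) ^^ t) P0"

definition tv_dist :: "point measure \<Rightarrow> point measure \<Rightarrow> real" where
  "tv_dist P Q = (SUP A\<in>sets Q. \<bar>measure P A - measure Q A\<bar>)"

text \<open>The infimum is attained unless the set is empty, when the mixing time is infinite.\<close>

definition mixing_time ::
    "nat \<Rightarrow> (point \<Rightarrow> point measure) \<Rightarrow> (point \<Rightarrow> real) \<Rightarrow> point measure \<Rightarrow> real \<Rightarrow> enat" where
  "mixing_time d K p P0 \<epsilon> = Inf {enat t | t. tv_dist (law K P0 t) (dens_measure d p) \<le> \<epsilon>}"

text \<open>
  Metropolis--Hastings kernels in Tierney's generality. \<open>Q\<close> is the proposal kernel and \<open>r\<close> is a
  density of \<open>\<pi>(dz) Q(z, dw)\<close> with respect to a symmetric measure \<open>\<nu>\<close>. If \<open>Q(z, _)\<close> has the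
  Lebesgue density \<open>q(z, _)\<close>, one may take Lebesgue measure for \<open>\<nu>\<close> and \<open>r(z, w) = \<pi>(z) q(z, w)\<close>,
  which gives the usual acceptance probability. The acceptance probability is
  unconstrained on the null set where \<open>r\<close> vanishes.
\<close>

definition metropolis_hastings ::
    "nat \<Rightarrow> (point \<Rightarrow> real) \<Rightarrow> (point \<Rightarrow> point measure) \<Rightarrow> bool" where
  "metropolis_hastings d p K \<longleftrightarrow>
     K \<in> leb d \<rightarrow>\<^sub>M prob_algebra (leb d) \<and>
     (\<exists>Q \<nu> r \<alpha>.
        Q \<in> leb d \<rightarrow>\<^sub>M prob_algebra (leb d) \<and>
        sets \<nu> = sets (leb d \<Otimes>\<^sub>M leb d) \<and> sigma_finite_measure \<nu> \<and>
        distr \<nu> \<nu> (\<lambda>(z, w). (w, z)) = \<nu> \<and>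
        r \<in> borel_measurable \<nu> \<and> (\<forall>u. (0::real) \<le> r u) \<and>
        (\<forall>A\<in>sets \<nu>. emeasure (density \<nu> (\<lambda>u. ennreal (r u))) A =
           (\<integral>\<^sup>+ z. emeasure (Q z) (Pair z -` A) \<partial>dens_measure d p)) \<and>
        \<alpha> \<in> borel_measurable \<nu> \<and> (\<forall>u. (0::real) \<le> \<alpha> u \<and> \<alpha> u \<le> 1) \<and>
        (\<forall>z\<in>euclid d. \<forall>w\<in>euclid d. 0 < r (z, w) \<longrightarrow> \<alpha> (z, w) = min 1 (r (w, z) / r (z, w))) \<and>
        (\<forall>z\<in>euclid d. \<forall>A\<in>sets (leb d).
           measure (K z) A =
             (\<integral> w. \<alpha> (z, w) * indicator A w \<partial>Q z) + (1 - (\<integral> w. \<alpha> (z, w) \<partial>Q z)) * indicator A z))"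

text \<open>
  A kernel family assigns a kernel to a dimension, a hyperparameter value of an arbitrary
  type \<open>'h\<close> and a target density.
\<close>

type_synonym 'h kernel_family =
  "nat \<Rightarrow> 'h \<Rightarrow> (point \<Rightarrow> real) \<Rightarrow> point \<Rightarrow> point measure"

definition mh_family :: "'h kernel_family \<Rightarrow> bool" where
  "mh_family \<K> \<longleftrightarrow>
     (\<forall>d\<ge>1. \<forall>h p. log_concave_density d p \<longrightarrow> metropolis_hastings d p (\<K> d h p))"

definition tuned ::
    "(real \<Rightarrow> nat \<Rightarrow> real \<Rightarrow> real \<Rightarrow> real \<Rightarrow> 'h) \<Rightarrow>
     real \<Rightarrow> nat \<Rightarrow> point measure \<Rightarrow> (point \<Rightarrow> real) \<Rightarrow> 'h" where
  "tuned \<tau> \<epsilon> d P0 p =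
     \<tau> \<epsilon> d (real_of_ereal (warmness d P0 p)) (real_of_ereal (smoothness d p))
       (real_of_ereal (isoper_const d p))"

definition bound_at ::
    "(real \<Rightarrow> nat \<Rightarrow> real \<Rightarrow> real \<Rightarrow> real) \<Rightarrow>
     real \<Rightarrow> nat \<Rightarrow> point measure \<Rightarrow> (point \<Rightarrow> real) \<Rightarrow> real" where
  "bound_at T \<epsilon> d P0 p = T \<epsilon> d (real_of_ereal (warmness d P0 p)) (cond_number d p)"

definition tuned_mixing_bound ::
    "'h kernel_family \<Rightarrow> (real \<Rightarrow> nat \<Rightarrow> real \<Rightarrow> real \<Rightarrow> real \<Rightarrow> 'h) \<Rightarrow>
     (real \<Rightarrow> nat \<Rightarrow> real \<Rightarrow> real \<Rightarrow> real) \<Rightarrow> bool" where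
  "tuned_mixing_bound \<K> \<tau> T \<longleftrightarrow>
     (\<forall>\<epsilon>>0. \<forall>d\<ge>1. \<forall>p P0.
        log_concave_density d p \<and> smoothness d p < \<infinity> \<and> 0 < isoper_const d p \<and>
        warm_start d P0 p \<longrightarrow>
        ereal_of_enat (mixing_time d (\<K> d (tuned \<tau> \<epsilon> d P0 p) p) p P0 \<epsilon>)
          \<le> ereal (bound_at T \<epsilon> d P0 p))"

text \<open>
  Only the values that can occur are constrained: condition numbers of probability densities are
  positive, and warm start constants are at least one.
\<close>

definition monotone_bound :: "(real \<Rightarrow> nat \<Rightarrow> real \<Rightarrow> real \<Rightarrow> real) \<Rightarrow> bool" where
  "monotone_bound T \<longleftrightarrow>
     (\<forall>\<epsilon>>0.
        (\<forall>\<beta>\<ge>1. \<forall>\<kappa>>0. strict_mono_on {1..} (\<lambda>d. T \<epsilon> d \<beta> \<kappa>)) \<and>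
        (\<forall>d\<ge>1. \<forall>\<kappa>>0. mono_on {1..} (\<lambda>\<beta>. T \<epsilon> d \<beta> \<kappa>)) \<and>
        (\<forall>d\<ge>1. \<forall>\<beta>\<ge>1. mono_on {0<..} (\<lambda>\<kappa>. T \<epsilon> d \<beta> \<kappa>)))"

end

theory Submission
  imports Defs
begin

text \<open>
  The bound sees a target only through its dimension, the warmness of the start and the condition
  number \<open>L / \<psi>\<^sup>2\<close>. The dimension drops strictly from \<open>nx + ny\<close> to \<open>ny\<close>, so it is enough that neither
  the warmness nor the condition number increases when \<open>x\<close> is integrated out.

  \<^item> Warmness (\<open>warm_with_marg\<close>): \<open>P0_marg\<close> is the law of \<open>y\<close> under \<open>P0_joint\<close>, and integrating
    \<open>p0 \<le> \<beta> \<pi>\<close> over \<open>x\<close> keeps the constant \<open>\<beta>\<close>.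

  \<^item> Isoperimetry (\<open>isoperimetric_marg\<close>): a partition of \<open>y\<close>-space pulls back to a partition of the
    joint space with the same masses, and since projections do not increase distances, the
    pulled-back sets are at least as far apart.

  \<^item> Smoothness (\<open>hessian_le_marg\<close>): writing \<open>E\<close> and \<open>Cov\<close> for the conditional law of \<open>x\<close> given \<open>y\<close>,
    the Hessian of \<open>- ln m\<close>, with \<open>m\<close> the marginal density, is \<open>E (\<nabla>\<^sub>y\<^sub>y V) - Cov (\<nabla>\<^sub>y V)\<close>. The first term
    is at most \<open>L\<close> and covariances are positive semidefinite.

  The Hessian formula requires differentiating twice under the integral over \<open>x\<close>. The dominating
  functions come from the descent inequality \<open>V (z + v) \<le> V z + \<nabla>V z \<bullet> v + L/2 |v|\<^sup>2\<close>, with no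
  growth estimate for \<open>V\<close>. With \<open>v = \<plusminus> e\<^sub>j\<close> it bounds \<open>(\<partial>\<^sub>j V)\<^sup>2 exp (- V)\<close> at a point by the density
  at two neighbours, and applied along a coordinate line it bounds the density on a segment by its
  values at the two ends of a longer one. The entries of the Hessian of \<open>V\<close> lie in \<open>[-L, L]\<close> because
  it is symmetric and, by convexity of \<open>V\<close>, positive semidefinite.

  Monotonicity in the condition number is only available for positive arguments, and the extended
  real constants are converted to reals. Both require the marginal to be nondegenerate. Its
  smoothness constant is positive, since otherwise the density would be log-convex along
  coordinate lines and hence not integrable (\<open>smoothness_marg_pos\<close>). Its isoperimetric constant is
  finite, because two half-spaces at distance one have positive mass (\<open>isoper_const_finite\<close>).
\<close>

section \<open>Lebesgue measure on blocks of coordinates\<close>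

lemma space_leb [simp]: "space (leb d) = euclid d"
  by (simp add: leb_def euclid_def space_PiM)

interpretation lborel_product: product_sigma_finite "\<lambda>_ :: nat. lborel :: real measure"
  by standard

lemma sigma_finite_leb: "sigma_finite_measure (leb d)"
  unfolding leb_def by (rule lborel_product.sigma_finite) simp

lemma joinp_in_euclid [simp]: "joinp nx ny x y \<in> euclid (nx + ny)"
  by (simp add: joinp_def euclid_def)

lemma ypart_in_euclid [simp]: "ypart nx ny z \<in> euclid ny"
  by (simp add: ypart_def euclid_def)

lemma ypart_joinp [simp]: "y \<in> euclid ny \<Longrightarrow> ypart nx ny (joinp nx ny x y) = y"
  by (auto simp: ypart_def joinp_def euclid_def PiE_def extensional_def)

lemma joinp_upd:
  "j < ny \<Longrightarrow> joinp nx ny x (y(j := t)) = (joinp nx ny x y)(nx + j := t)"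
  by (rule ext) (auto simp: joinp_def)

lemma upd_in_euclid: "z \<in> euclid d \<Longrightarrow> i < d \<Longrightarrow> z(i := t) \<in> euclid d"
  by (auto simp: euclid_def PiE_def extensional_def)

lemma measurable_joinp [measurable]:
  "(\<lambda>(x, y). joinp nx ny x y) \<in> leb nx \<Otimes>\<^sub>M leb ny \<rightarrow>\<^sub>M leb (nx + ny)"
  unfolding leb_def joinp_def split_beta'
proof (rule measurable_restrict)
  fix i assume i: "i \<in> {..<nx + ny}"
  show "(\<lambda>p. if i < nx then fst p i else snd p (i - nx))
    \<in> Pi\<^sub>M {..<nx} (\<lambda>_. lborel) \<Otimes>\<^sub>M Pi\<^sub>M {..<ny} (\<lambda>_. lborel) \<rightarrow>\<^sub>M (lborel :: real measure)"
    using i by (cases "i < nx") simp_all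
qed

lemma measurable_joinp_right: "y \<in> euclid ny \<Longrightarrow>
  (\<lambda>x. joinp nx ny x y) \<in> leb nx \<rightarrow>\<^sub>M leb (nx + ny)"
  using measurable_compose[OF measurable_Pair2' measurable_joinp] by simp

lemma measurable_ypart [measurable]: "ypart nx ny \<in> leb (nx + ny) \<rightarrow>\<^sub>M leb ny"
  unfolding leb_def ypart_def
  by (rule measurable_restrict) (rule measurable_component_singleton, simp)

lemma joinp_box:
  "joinp nx ny x y \<in> Pi\<^sub>E {..<nx + ny} A \<longleftrightarrow>
    (\<forall>i<nx. x i \<in> A i) \<and> (\<forall>i<ny. y i \<in> A (nx + i))"
proof -
  have "(\<forall>i<nx + ny. P i) \<longleftrightarrow> (\<forall>i<nx. P i) \<and> (\<forall>i<ny. P (nx + i))" for P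
    by (metis add_diff_inverse_nat nat_add_left_cancel_less trans_less_add1)
  from this[of "\<lambda>i. joinp nx ny x y i \<in> A i"] show ?thesis
    by (auto simp: joinp_def PiE_iff Ball_def)
qed

lemma distr_joinp:
  "distr (leb nx \<Otimes>\<^sub>M leb ny) (leb (nx + ny)) (\<lambda>(x, y). joinp nx ny x y) = leb (nx + ny)"
proof -
  interpret Y: sigma_finite_measure "leb ny" by (rule sigma_finite_leb)
  have "distr (leb nx \<Otimes>\<^sub>M leb ny) (leb (nx + ny)) (\<lambda>(x, y). joinp nx ny x y)
      = Pi\<^sub>M {..<nx + ny} (\<lambda>_. lborel)"
  proof (rule lborel_product.PiM_eqI)
    fix A :: "nat \<Rightarrow> real set" assume A: "\<And>i. i \<in> {..<nx + ny} \<Longrightarrow> A i \<in> sets lborel"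
    have box: "Pi\<^sub>E {..<nx + ny} A \<in> sets (leb (nx + ny))"
      unfolding leb_def using A by (intro sets_PiM_I_finite) auto
    have X: "Pi\<^sub>E {..<nx} A \<in> sets (leb nx)"
      unfolding leb_def using A by (intro sets_PiM_I_finite) auto
    have Y: "Pi\<^sub>E {..<ny} (\<lambda>i. A (nx + i)) \<in> sets (leb ny)"
      unfolding leb_def using A by (intro sets_PiM_I_finite) auto
    have "(\<lambda>(x, y). joinp nx ny x y) -` Pi\<^sub>E {..<nx + ny} A \<inter> space (leb nx \<Otimes>\<^sub>M leb ny)
        = Pi\<^sub>E {..<nx} A \<times> Pi\<^sub>E {..<ny} (\<lambda>i. A (nx + i))"
      by (safe; simp add: joinp_box space_pair_measure)
        (auto simp: euclid_def PiE_iff extensional_def)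
    then have "emeasure (distr (leb nx \<Otimes>\<^sub>M leb ny) (leb (nx + ny)) (\<lambda>(x, y). joinp nx ny x y))
        (Pi\<^sub>E {..<nx + ny} A) = emeasure (leb nx) (Pi\<^sub>E {..<nx} A) *
          emeasure (leb ny) (Pi\<^sub>E {..<ny} (\<lambda>i. A (nx + i)))"
      using X Y by (simp add: emeasure_distr box Y.emeasure_pair_measure_Times)
    also have "emeasure (leb nx) (Pi\<^sub>E {..<nx} A) = (\<Prod>i<nx. emeasure lborel (A i))"
      unfolding leb_def using A by (intro lborel_product.emeasure_PiM) auto
    also have "emeasure (leb ny) (Pi\<^sub>E {..<ny} (\<lambda>i. A (nx + i))) = (\<Prod>i<ny. emeasure lborel (A (nx + i)))"
      unfolding leb_def using A by (intro lborel_product.emeasure_PiM) auto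
    also have "(\<Prod>i<ny. emeasure lborel (A (nx + i))) = (\<Prod>i=nx..<nx + ny. emeasure lborel (A i))"
      using prod.shift_bounds_nat_ivl[of "\<lambda>i. emeasure lborel (A i)" 0 nx ny]
      by (simp add: atLeast0LessThan add.commute)
    also have "(\<Prod>i<nx. emeasure lborel (A i)) * (\<Prod>i=nx..<nx + ny. emeasure lborel (A i))
        = (\<Prod>i<nx + ny. emeasure lborel (A i))"
      by (subst prod.union_disjoint[symmetric]) (auto intro!: prod.cong)
    finally show "emeasure (distr (leb nx \<Otimes>\<^sub>M leb ny) (leb (nx + ny)) (\<lambda>(x, y). joinp nx ny x y))
        (Pi\<^sub>E {..<nx + ny} A) = (\<Prod>i\<in>{..<nx + ny}. emeasure lborel (A i))" .
  qed (simp_all add: leb_def)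
  then show ?thesis by (simp add: leb_def)
qed

lemma nn_integral_leb_joinp:
  assumes f: "f \<in> borel_measurable (leb (nx + ny))"
  shows "(\<integral>\<^sup>+ z. f z \<partial>leb (nx + ny)) = (\<integral>\<^sup>+ y. \<integral>\<^sup>+ x. f (joinp nx ny x y) \<partial>leb nx \<partial>leb ny)"
proof -
  interpret pair_sigma_finite "leb nx" "leb ny"
    by (simp add: pair_sigma_finite_def sigma_finite_leb)
  note [measurable] = f
  have "(\<integral>\<^sup>+ z. f z \<partial>leb (nx + ny))
      = (\<integral>\<^sup>+ z. f z \<partial>distr (leb nx \<Otimes>\<^sub>M leb ny) (leb (nx + ny)) (\<lambda>(x, y). joinp nx ny x y))"
    by (simp add: distr_joinp)
  also have "\<dots> = (\<integral>\<^sup>+ p. f (joinp nx ny (fst p) (snd p)) \<partial>(leb nx \<Otimes>\<^sub>M leb ny))"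
    by (subst nn_integral_distr) (auto simp: split_beta')
  also have "\<dots> = (\<integral>\<^sup>+ y. \<integral>\<^sup>+ x. f (joinp nx ny x y) \<partial>leb nx \<partial>leb ny)"
    by (subst nn_integral_snd[symmetric]) (auto simp: split_beta')
  finally show ?thesis .
qed

text \<open>
  Reflection in a point lets one pick, for a given \<open>z\<close>, a generic \<open>w\<close> whose mirror image
  is generic as well; this is how statements holding almost everywhere reach every point.
\<close>

lemma distr_reflect_leb:
  "distr (leb d) (leb d) (\<lambda>w. \<lambda>i\<in>{..<d}. 2 * z i - w i) = leb d"
proof -
  have meas: "(\<lambda>w. \<lambda>i\<in>{..<d}. 2 * z i - w i) \<in> leb d \<rightarrow>\<^sub>M leb d"
    unfolding leb_def
    by (intro measurable_restrict) measurable
  have "distr (leb d) (leb d) (\<lambda>w. \<lambda>i\<in>{..<d}. 2 * z i - w i) = Pi\<^sub>M {..<d} (\<lambda>_. lborel)"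
  proof (rule lborel_product.PiM_eqI)
    fix A :: "nat \<Rightarrow> real set" assume A: "\<And>i. i \<in> {..<d} \<Longrightarrow> A i \<in> sets lborel"
    have box: "Pi\<^sub>E {..<d} A \<in> sets (leb d)"
      unfolding leb_def using A by (intro sets_PiM_I_finite) auto
    have refl: "emeasure lborel ((\<lambda>t. 2 * z i - t) -` A i) = emeasure lborel (A i)"
      and m: "(\<lambda>t. 2 * z i - t) -` A i \<in> sets lborel" if "i < d" for i
    proof -
      have Ai: "A i \<in> sets borel" using A that by auto
      show m: "(\<lambda>t. 2 * z i - t) -` A i \<in> sets lborel"
        using measurable_sets[of "\<lambda>t. 2 * z i - t" lborel lborel "A i"] Ai by simp
      have "emeasure lborel (A i) = emeasure (distr lborel borel (\<lambda>t. 2 * z i + (-1) * t)) (A i)"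
        by (subst lborel_real_affine[of "-1" "2 * z i"]) (auto simp: density_1 one_ennreal_def[symmetric])
      also have "\<dots> = emeasure lborel ((\<lambda>t. 2 * z i - t) -` A i)"
        using Ai by (subst emeasure_distr) auto
      finally show "emeasure lborel ((\<lambda>t. 2 * z i - t) -` A i) = emeasure lborel (A i)" by simp
    qed
    have "(\<lambda>w. \<lambda>i\<in>{..<d}. 2 * z i - w i) -` Pi\<^sub>E {..<d} A \<inter> space (leb d)
        = Pi\<^sub>E {..<d} (\<lambda>i. (\<lambda>t. 2 * z i - t) -` A i)"
      by (auto simp: euclid_def PiE_iff)
    then have "emeasure (distr (leb d) (leb d) (\<lambda>w. \<lambda>i\<in>{..<d}. 2 * z i - w i)) (Pi\<^sub>E {..<d} A)
        = emeasure (leb d) (Pi\<^sub>E {..<d} (\<lambda>i. (\<lambda>t. 2 * z i - t) -` A i))"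
      by (simp add: emeasure_distr[OF meas box])
    also have "\<dots> = (\<Prod>i<d. emeasure lborel (A i))"
      unfolding leb_def by (subst lborel_product.emeasure_PiM) (auto simp: m[simplified] refl)
    finally show "emeasure (distr (leb d) (leb d) (\<lambda>w. \<lambda>i\<in>{..<d}. 2 * z i - w i)) (Pi\<^sub>E {..<d} A)
        = (\<Prod>i\<in>{..<d}. emeasure lborel (A i))" .
  qed (simp_all add: leb_def)
  then show ?thesis by (simp add: leb_def)
qed

lemma emeasure_PiM_lborel_box:
  "finite I \<Longrightarrow> emeasure (Pi\<^sub>M I (\<lambda>_ :: nat. lborel)) (Pi\<^sub>E I (\<lambda>i. {a i..a i + 1 :: real})) = 1"
  by (subst lborel_product.emeasure_PiM) auto

lemma emeasure_PiM_lborel_pos: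
  assumes I: "finite I" and A: "A \<in> sets (Pi\<^sub>M I (\<lambda>_ :: nat. lborel))"
    and box: "Pi\<^sub>E I (\<lambda>i. {a i..a i + 1 :: real}) \<subseteq> A"
  shows "emeasure (Pi\<^sub>M I (\<lambda>_. lborel)) A \<noteq> 0"
  using emeasure_mono[OF box A] emeasure_PiM_lborel_box[OF I, of a] by auto

lemma emeasure_leb_space_neq_0: "emeasure (leb d) (euclid d) \<noteq> 0"
  using emeasure_PiM_lborel_pos[of "{..<d}" "euclid d" "\<lambda>_. 0"] sets.top[of "leb d"]
  by (auto simp: leb_def[symmetric] euclid_def)

text \<open>
  Continuity refers to the product topology on all sequences, and the inclusion of \<open>leb d\<close>
  there is measurable because the coordinates from \<open>d\<close> on are constant.
\<close>

lemma borel_measurable_leb_continuous: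
  assumes "continuous_on (euclid d) f"
  shows "(f :: point \<Rightarrow> real) \<in> borel_measurable (leb d)"
proof -
  have "(\<lambda>z. z) \<in> leb d \<rightarrow>\<^sub>M (borel :: point measure)"
    unfolding sets_PiM_equal_borel[symmetric, THEN measurable_cong_sets[OF refl]]
  proof (rule measurable_PiM_single')
    fix i
    show "(\<lambda>z. z i) \<in> leb d \<rightarrow>\<^sub>M (borel :: real measure)"
    proof (cases "i < d")
      case True
      then show ?thesis unfolding leb_def
        using measurable_component_singleton[of i "{..<d}" "\<lambda>_. lborel"] by simp
    next
      case False
      have "(\<lambda>z. undefined) \<in> leb d \<rightarrow>\<^sub>M (borel :: real measure)" by simp
      also have "?this \<longleftrightarrow> ?thesis"
        using False by (intro measurable_cong) (auto simp: euclid_def PiE_iff extensional_def)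
      finally show ?thesis .
    qed
  qed auto
  then have "(\<lambda>z. z) \<in> leb d \<rightarrow>\<^sub>M restrict_space borel (euclid d)"
    by (intro measurable_restrict_space2) auto
  from measurable_compose[OF this borel_measurable_continuous_on_restrict[OF assms]]
  show ?thesis .
qed

section \<open>Directional derivatives of twice continuously differentiable functions\<close>

definition along :: "nat \<Rightarrow> point \<Rightarrow> real \<Rightarrow> point \<Rightarrow> point" where
  "along d z t v = (\<lambda>i\<in>{..<d}. z i + t * v i)"

lemma along_in_euclid [simp]: "along d z t v \<in> euclid d"
  by (simp add: along_def euclid_def)

lemma along_0 [simp]: "z \<in> euclid d \<Longrightarrow> along d z 0 v = z"
  by (auto simp: along_def euclid_def PiE_def extensional_def)

lemma C2_partial: "C2 d f \<Longrightarrow> i < d \<Longrightarrow> C1 d (partial i f)"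
  by (simp add: C2_def)

lemma C2_C1: "C2 d f \<Longrightarrow> C1 d f"
  by (simp add: C2_def)

lemma C1_partial:
  assumes "C1 d f" "i < d" "z \<in> euclid d"
  shows "((\<lambda>t. f (z(i := t))) has_real_derivative partial i f (z(i := a))) (at a)"
proof -
  have "line f i (z(i := a)) differentiable (at ((z(i := a)) i))"
    using assms upd_in_euclid unfolding C1_def by blast
  then have "(line f i (z(i := a)) has_real_derivative deriv (line f i (z(i := a))) a) (at a)"
    by (simp add: DERIV_deriv_iff_real_differentiable)
  moreover have "line f i (z(i := a)) = (\<lambda>t. f (z(i := t)))"
    by (simp add: line_def fun_eq_iff)
  ultimately show ?thesis
    by (simp add: partial_def)
qed

lemma continuous_on_euclid_path:
  assumes f: "continuous_on (euclid d) f" and g: "\<And>p. p \<in> S \<Longrightarrow> g p \<in> euclid d"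
    and coord: "\<And>i. i < d \<Longrightarrow> continuous_on S (\<lambda>p. g p i)"
  shows "continuous_on S (\<lambda>p. f (g p) :: real)"
proof (rule continuous_on_compose2[OF f])
  show "continuous_on S g"
  proof (rule continuous_on_coordinatewise_then_product)
    fix i
    show "continuous_on S (\<lambda>p. g p i)"
    proof (cases "i < d")
      case False
      then have "g p i = undefined" if "p \<in> S" for p
        using g[OF that] by (auto simp: euclid_def PiE_def extensional_def)
      then show ?thesis by (simp cong: continuous_on_cong)
    qed (rule coord)
  qed
qed (use g in auto)

text \<open>
  A derivative in one variable at a point and a jointly continuous derivative in the other
  already give total differentiability there, so the diagonal can be differentiated.
\<close>

lemma has_real_derivative_diagonal:
  fixes h :: "real \<Rightarrow> real \<Rightarrow> real"
  assumes fst: "((\<lambda>s. h s a) has_real_derivative A) (at a)"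
    and snd: "\<And>s t. ((\<lambda>t. h s t) has_real_derivative B s t) (at t)"
    and cont: "continuous_on UNIV (\<lambda>(s, t). B s t)"
  shows "((\<lambda>t. h t t) has_real_derivative A + B a a) (at a)"
proof -
  have "((\<lambda>(s, t). h s t) has_derivative (\<lambda>(u, v). A * u + blinfun_mult_right (B a a) v))
      (at (a, a) within UNIV \<times> UNIV)"
  proof (rule has_derivative_partialsI[where fy = "\<lambda>s t. blinfun_mult_right (B s t)"])
    show "((\<lambda>s. h s a) has_derivative (*) A) (at a within UNIV)"
      using fst by (simp add: has_field_derivative_def)
    show "((\<lambda>t. h s t) has_derivative blinfun_mult_right (B s t)) (at t within UNIV)" for s t
      using snd[of s t] by (simp add: has_field_derivative_def)
    have "continuous (at (a, a)) (\<lambda>(s, t). B s t)"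
      using cont by (simp add: continuous_on_eq_continuous_at)
    then have "continuous (at (a, a)) (\<lambda>p. blinfun_mult_right (case p of (s, t) \<Rightarrow> B s t))"
      by (rule bounded_linear.continuous[OF bounded_linear_blinfun_mult_right])
    then show "continuous (at (a, a) within UNIV \<times> UNIV) (\<lambda>(s, t). blinfun_mult_right (B s t))"
      by (simp add: split_beta')
  qed auto
  then have H: "((\<lambda>(s, t). h s t) has_derivative (\<lambda>(u, v). A * u + B a a * v)) (at (a, a))"
    by simp
  have D: "((\<lambda>t :: real. (t, t)) has_derivative (\<lambda>u. (u, u))) (at a)"
    by (auto intro!: derivative_eq_intros)
  have "((\<lambda>t. (\<lambda>(s, t). h s t) (t, t)) has_derivative (\<lambda>u. (\<lambda>(u, v). A * u + B a a * v) (u, u))) (at a)"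
    using has_derivative_compose[OF D H] by simp
  moreover have "(*) (A + B a a) = (\<lambda>u. A * u + B a a * u)"
    by (simp add: fun_eq_iff distrib_right)
  ultimately show ?thesis
    by (simp add: has_field_derivative_def)
qed

text \<open>
  Chain rule from continuous partial derivatives, by moving one further coordinate at a time:
  the curve that moves only the first \<open>k + 1\<close> coordinates is the diagonal of a function of two
  parameters, one for the first \<open>k\<close> coordinates and one for coordinate \<open>k\<close>.
\<close>

lemma C1_along_derivative:
  assumes f: "C1 d f"
  shows "((\<lambda>t. f (along d z t v)) has_real_derivative
    (\<Sum>i<d. v i * partial i f (along d z a v))) (at a)"
proof -
  \<comment> \<open>The first \<open>k\<close> coordinates move with \<open>s\<close>; the others rest at parameter \<open>a\<close>.\<close>
  define R where "R k s = (\<lambda>i\<in>{..<d}. z i + (if i < k then s else a) * v i)" for k :: nat and s :: real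
  have R_euclid: "R k s \<in> euclid d" for k s
    by (simp add: R_def euclid_def)
  have R_a: "R k a = along d z a v" for k
    by (simp add: R_def along_def cong: if_cong)
  have "((\<lambda>s. f (R k s)) has_real_derivative (\<Sum>i<k. v i * partial i f (along d z a v))) (at a)"
    if "k \<le> d" for k
    using that
  proof (induction k)
    case 0
    have "R 0 s = R 0 a" for s by (simp add: R_def)
    then have "(\<lambda>s. f (R 0 s)) = (\<lambda>s. f (R 0 a))" by metis
    then show ?case by simp
  next
    case (Suc k)
    then have k: "k < d" by simp
    define h where "h s t = f ((R k s)(k := z k + t * v k))" for s t
    have diag: "R (Suc k) t = (R k t)(k := z k + t * v k)" for t
      using k by (auto simp: R_def less_Suc_eq)
    have base: "R k s = (R k s)(k := z k + a * v k)" for s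
      using k by (auto simp: R_def)
    have "((\<lambda>t. h t t) has_real_derivative (\<Sum>i<k. v i * partial i f (along d z a v))
        + v k * partial k f ((R k a)(k := z k + a * v k))) (at a)"
    proof (rule has_real_derivative_diagonal[where h = h and B = "\<lambda>s t. v k * partial k f ((R k s)(k := z k + t * v k))"])
      show "((\<lambda>s. h s a) has_real_derivative (\<Sum>i<k. v i * partial i f (along d z a v))) (at a)"
        using Suc by (simp add: h_def base[symmetric])
      show "((\<lambda>t. h s t) has_real_derivative v k * partial k f ((R k s)(k := z k + t * v k))) (at t)" for s t
        unfolding h_def
        by (rule DERIV_cong[OF DERIV_chain2[where g = "\<lambda>t. z k + t * v k" and f = "\<lambda>t. f ((R k s)(k := t))",
              OF C1_partial[OF f k R_euclid]]])
          (auto intro!: derivative_eq_intros)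
      have "continuous_on UNIV (\<lambda>p. partial k f ((R k (fst p))(k := z k + snd p * v k)))"
      proof (rule continuous_on_euclid_path[of d "partial k f"])
        show "continuous_on (euclid d) (partial k f)" using f k by (simp add: C1_def)
        show "(R k (fst p))(k := z k + snd p * v k) \<in> euclid d" for p
          using R_euclid k by (rule upd_in_euclid)
        show "continuous_on UNIV (\<lambda>p. ((R k (fst p))(k := z k + snd p * v k)) i)" if "i < d" for i
          using that by (cases "i = k"; cases "i < k")
            (auto simp: R_def intro!: continuous_intros)
      qed
      then show "continuous_on UNIV (\<lambda>(s, t). v k * partial k f ((R k s)(k := z k + t * v k)))"
        by (auto simp: split_beta' intro!: continuous_intros)
    qed
    then show ?case
      by (simp add: h_def diag[symmetric] R_a base[of a, unfolded R_a, symmetric])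
  qed
  from this[of d] show ?thesis
    by (simp add: R_def along_def cong: restrict_cong)
qed

lemma C2_along_second_derivative:
  assumes f: "C2 d f"
  shows "((\<lambda>t. \<Sum>i<d. v i * partial i f (along d z t v)) has_real_derivative
    (\<Sum>i<d. \<Sum>j<d. v i * v j * partial i (partial j f) (along d z a v))) (at a)"
proof -
  have "((\<lambda>t. \<Sum>j<d. v j * partial j f (along d z t v)) has_real_derivative
    (\<Sum>j<d. v j * (\<Sum>i<d. v i * partial i (partial j f) (along d z a v)))) (at a)"
    by (intro DERIV_sum DERIV_cmult C1_along_derivative C2_partial[OF f]) simp
  also have "(\<Sum>j<d. v j * (\<Sum>i<d. v i * partial i (partial j f) (along d z a v)))
      = (\<Sum>i<d. \<Sum>j<d. v i * v j * partial i (partial j f) (along d z a v))"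
    by (subst sum.swap) (simp add: sum_distrib_left mult_ac)
  finally show ?thesis .
qed

text \<open>
  Taylor's formula along the segment from \<open>z\<close> to \<open>z + v\<close>: the remainder is the quadratic form of
  the Hessian at an intermediate point.
\<close>

lemma hessian_le_descent:
  assumes f: "C2 d f" and H: "\<And>z. z \<in> euclid d \<Longrightarrow> hessian_le d f z c"
    and z: "z \<in> euclid d"
  shows "f (along d z 1 v) \<le> f z + (\<Sum>i<d. v i * partial i f z) + c / 2 * (\<Sum>i<d. (v i)\<^sup>2)"
proof -
  define D where "D m t = (if m = 0 then f (along d z t v) else if m = 1
     then (\<Sum>i<d. v i * partial i f (along d z t v))
     else (\<Sum>i<d. \<Sum>j<d. v i * v j * partial i (partial j f) (along d z t v)))" for m :: nat and t
  have D0: "D 0 = (\<lambda>t. f (along d z t v))"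
    and D1: "D (Suc 0) = (\<lambda>t. \<Sum>i<d. v i * partial i f (along d z t v))"
    and D2: "D 2 = (\<lambda>t. \<Sum>i<d. \<Sum>j<d. v i * v j * partial i (partial j f) (along d z t v))"
    by (simp_all add: D_def fun_eq_iff)
  have "\<exists>t. 0 < t \<and> t < 1 \<and> f (along d z 1 v) =
      (\<Sum>m<2. (D m 0 / fact m) * (1 - 0) ^ m) + (D 2 t / fact 2) * (1 - 0)\<^sup>2"
  proof (rule Taylor_up[where a = 0])
    show "\<forall>m t. m < 2 \<and> 0 \<le> t \<and> t \<le> 1 \<longrightarrow> (D m has_real_derivative D (Suc m) t) (at t)"
      using C1_along_derivative[OF C2_C1[OF f]] C2_along_second_derivative[OF f]
      by (auto simp: D0 D1 D2 less_2_cases_iff simp flip: numeral_2_eq_2)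
  qed (auto simp: D_def)
  then obtain t where "f (along d z 1 v) = D 0 0 + D 1 0 + D 2 t / 2"
    by (auto simp: numeral_2_eq_2)
  moreover have "D 2 t \<le> c * (\<Sum>i<d. (v i)\<^sup>2)"
    using H[of "along d z t v"] by (simp add: D_def hessian_le_def)
  ultimately show ?thesis
    using z by (simp add: D_def)
qed

text \<open>
  If \<open>b\<close> were negative, \<open>g'\<close> would decrease to the right of \<open>a\<close>, and the tangents at \<open>a\<close> and at a nearby
  point would contradict each other.
\<close>

lemma convex_second_derivative_nonneg:
  fixes g :: "real \<Rightarrow> real"
  assumes cvx: "convex_on UNIV g" and g: "\<And>t. (g has_real_derivative g' t) (at t)"
    and g': "(g' has_real_derivative b) (at a)"
  shows "0 \<le> b"
proof (rule ccontr)
  assume "\<not> 0 \<le> b"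
  then obtain \<delta> where \<delta>: "\<delta> > 0" "\<And>h. 0 < h \<Longrightarrow> h < \<delta> \<Longrightarrow> g' (a + h) < g' a"
    using DERIV_neg_dec_right[OF g'] by auto
  define t where "t = a + \<delta> / 2"
  have t: "g' t < g' a" "a < t" using \<delta>(1) \<delta>(2)[of "\<delta> / 2"] by (auto simp: t_def)
  have "g t \<ge> g a + g' a * (t - a)" "g a \<ge> g t + g' t * (a - t)"
    using convex_on_imp_above_tangent[OF cvx, of a t "g' a"]
      convex_on_imp_above_tangent[OF cvx, of t a "g' t"] g[THEN has_field_derivative_at_within]
    by (auto simp: algebra_simps)
  then have "(g' a - g' t) * (t - a) \<le> 0" by (simp add: algebra_simps)
  moreover have "(g' a - g' t) * (t - a) > 0" using t by simp
  ultimately show False by simp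
qed

lemma convex_fun_hessian_nonneg:
  assumes f: "C2 d f" and cvx: "convex_fun d f" and z: "z \<in> euclid d"
  shows "0 \<le> (\<Sum>i<d. \<Sum>j<d. v i * v j * partial i (partial j f) z)"
proof -
  have "convex_on UNIV (\<lambda>t. f (along d z t v))"
  proof (rule convex_onI)
    fix t a b :: real
    assume "0 < t" "t < 1"
    then have "f (\<lambda>i\<in>{..<d}. (1 - t) * along d z a v i + t * along d z b v i)
        \<le> (1 - t) * f (along d z a v) + t * f (along d z b v)"
      using cvx unfolding convex_fun_def by auto
    moreover have "(\<lambda>i\<in>{..<d}. (1 - t) * along d z a v i + t * along d z b v i)
        = along d z ((1 - t) *\<^sub>R a + t *\<^sub>R b) v"
      by (auto simp: along_def algebra_simps)
    ultimately show "f (along d z ((1 - t) *\<^sub>R a + t *\<^sub>R b) v)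
        \<le> (1 - t) * f (along d z a v) + t * f (along d z b v)" by simp
  qed simp
  from convex_second_derivative_nonneg[OF this C1_along_derivative[OF C2_C1[OF f]]
      C2_along_second_derivative[OF f, of v z 0]]
  show ?thesis using z by simp
qed

text \<open>Schwarz's theorem on mixed partial derivatives: both are limits of the mixed second
  difference over a shrinking square, by the mean value theorem.\<close>

lemma mixed_difference_mvt:
  assumes f: "C2 d f" and i: "i < d" and j: "j < d" and ij: "i \<noteq> j" and z: "z \<in> euclid d"
    and h: "0 < h"
  shows "\<exists>s t. z i < s \<and> s < z i + h \<and> z j < t \<and> t < z j + h \<and>
    f (z(i := z i + h, j := z j + h)) - f (z(j := z j + h)) - f (z(i := z i + h)) + f z
      = h * h * partial j (partial i f) (z(i := s, j := t))"
proof -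
  define q where "q s = f (z(i := s, j := z j + h)) - f (z(i := s))" for s
  have q: "(q has_real_derivative partial i f (z(i := s, j := z j + h)) - partial i f (z(i := s))) (at s)" for s
    unfolding q_def
    using C1_partial[OF C2_C1[OF f] i upd_in_euclid[OF z j], of "z j + h" s] C1_partial[OF C2_C1[OF f] i z, of s]
    by (intro DERIV_diff) (simp_all add: fun_upd_twist[OF ij])
  obtain s where s: "z i < s" "s < z i + h"
    and qs: "q (z i + h) - q (z i) = h * (partial i f (z(i := s, j := z j + h)) - partial i f (z(i := s)))"
    using MVT2[of "z i" "z i + h" q, OF _ q] h by auto
  have p: "((\<lambda>t. partial i f (z(i := s, j := t))) has_real_derivative
      partial j (partial i f) (z(i := s, j := t))) (at t)" for t
    using C1_partial[OF C2_partial[OF f i] j upd_in_euclid[OF z i]] .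
  obtain t where t: "z j < t" "t < z j + h"
    and pt: "partial i f (z(i := s, j := z j + h)) - partial i f (z(i := s, j := z j))
      = h * partial j (partial i f) (z(i := s, j := t))"
    using MVT2[of "z j" "z j + h" "\<lambda>t. partial i f (z(i := s, j := t))", OF _ p] h by auto
  have "z(i := s, j := z j) = z(i := s)" for s using ij by auto
  with pt qs have "q (z i + h) - q (z i) = h * h * partial j (partial i f) (z(i := s, j := t))"
    by simp
  then show ?thesis
    using s t ij by (intro exI[of _ s] exI[of _ t]) (simp add: q_def algebra_simps)
qed

lemma C2_mixed_partials:
  assumes f: "C2 d f" and i: "i < d" and j: "j < d" and z: "z \<in> euclid d"
  shows "partial i (partial j f) z = partial j (partial i f) z"
proof (cases "i = j")
  case False
  have lim: "(\<lambda>n. partial k (partial l f) (z(i := s n, j := t n))) \<longlonglongrightarrow> partial k (partial l f) z"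
    if kl: "k < d" "l < d" and s: "\<And>n. z i < s n \<and> s n < z i + inverse (real (Suc n))"
      and t: "\<And>n. z j < t n \<and> t n < z j + inverse (real (Suc n))" for k l s t
  proof -
    have "continuous_on UNIV (\<lambda>p. partial k (partial l f) (z(i := fst p, j := snd p)))"
    proof (rule continuous_on_euclid_path[of d "partial k (partial l f)"])
      show "continuous_on (euclid d) (partial k (partial l f))"
        using C2_partial[OF f kl(2)] kl(1) by (simp add: C1_def)
      show "z(i := fst p, j := snd p) \<in> euclid d" for p
        using z i j by (simp add: upd_in_euclid)
      show "continuous_on UNIV (\<lambda>p. (z(i := fst p, j := snd p)) m)" for m
        by (cases "m = j"; cases "m = i") (auto intro!: continuous_intros)
    qed
    moreover have "s \<longlonglongrightarrow> z i"
      using s by (intro tendsto_sandwich[OF _ _ tendsto_const LIMSEQ_inverse_real_of_nat_add[of "z i"]])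
        (auto intro!: always_eventually less_imp_le)
    moreover have "t \<longlonglongrightarrow> z j"
      using t by (intro tendsto_sandwich[OF _ _ tendsto_const LIMSEQ_inverse_real_of_nat_add[of "z j"]])
        (auto intro!: always_eventually less_imp_le)
    ultimately show ?thesis
      using continuous_on_tendsto_compose[of UNIV "\<lambda>p. partial k (partial l f) (z(i := fst p, j := snd p))"
          "\<lambda>n. (s n, t n)" "(z i, z j)" sequentially]
      by (auto intro!: tendsto_Pair)
  qed
  define h where "h n = inverse (real (Suc n))" for n
  define A where "A n = f (z(i := z i + h n, j := z j + h n)) - f (z(j := z j + h n)) - f (z(i := z i + h n)) + f z" for n
  have h: "0 < h n" for n by (simp add: h_def)
  have "\<forall>n. \<exists>s t. z i < s \<and> s < z i + h n \<and> z j < t \<and> t < z j + h n \<and>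
      A n = h n * h n * partial j (partial i f) (z(i := s, j := t))"
    using mixed_difference_mvt[OF f i j False z h] by (simp add: A_def)
  then obtain s t where st: "\<And>n. z i < s n \<and> s n < z i + h n" "\<And>n. z j < t n \<and> t n < z j + h n"
      "\<And>n. A n = h n * h n * partial j (partial i f) (z(i := s n, j := t n))"
    by metis
  have "\<forall>n. \<exists>s t. z i < s \<and> s < z i + h n \<and> z j < t \<and> t < z j + h n \<and>
      A n = h n * h n * partial i (partial j f) (z(i := s, j := t))"
  proof
    fix n
    show "\<exists>s t. z i < s \<and> s < z i + h n \<and> z j < t \<and> t < z j + h n \<and>
      A n = h n * h n * partial i (partial j f) (z(i := s, j := t))"
      using mixed_difference_mvt[OF f j i False[symmetric] z h[of n]]
      unfolding A_def fun_upd_twist[OF False] by (elim exE conjE) (intro exI conjI; assumption?; linarith?)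
  qed
  then obtain s' t' where st': "\<And>n. z i < s' n \<and> s' n < z i + h n" "\<And>n. z j < t' n \<and> t' n < z j + h n"
      "\<And>n. A n = h n * h n * partial i (partial j f) (z(i := s' n, j := t' n))"
    by metis
  have "partial j (partial i f) (z(i := s n, j := t n)) = partial i (partial j f) (z(i := s' n, j := t' n))" for n
    using st(3)[of n] st'(3)[of n] h[of n] by simp
  moreover have "(\<lambda>n. partial j (partial i f) (z(i := s n, j := t n))) \<longlonglongrightarrow> partial j (partial i f) z"
    by (rule lim) (use i j st in \<open>auto simp: h_def\<close>)
  moreover have "(\<lambda>n. partial i (partial j f) (z(i := s' n, j := t' n))) \<longlonglongrightarrow> partial i (partial j f) z"
    by (rule lim) (use i j st' in \<open>auto simp: h_def\<close>)
  ultimately show ?thesis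
    using LIMSEQ_unique by simp
qed simp

lemma sum_two_indices:
  fixes a b :: real and H :: "nat \<Rightarrow> nat \<Rightarrow> real"
  assumes "i < d" "j < d" "i \<noteq> j"
  defines "v \<equiv> \<lambda>k. (if k = i then a else 0) + (if k = j then b else 0)"
  shows "(\<Sum>k<d. \<Sum>l<d. v k * v l * H k l) = a * a * H i i + a * b * H i j + b * a * H j i + b * b * H j j"
proof -
  have *: "(\<Sum>k<d. v k * g k) = a * g i + b * g j" for g
    using assms(1,2) by (simp add: v_def distrib_right sum.distrib if_distrib[of "\<lambda>x. x * _"] cong: if_cong)
  have "(\<Sum>k<d. \<Sum>l<d. v k * v l * H k l) = (\<Sum>k<d. v k * (\<Sum>l<d. v l * H k l))"
    by (simp add: sum_distrib_left mult_ac)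
  then show ?thesis unfolding * by (simp add: algebra_simps)
qed

lemma sum_one_index:
  fixes H :: "nat \<Rightarrow> nat \<Rightarrow> real"
  assumes "i < d"
  defines "v \<equiv> \<lambda>k. if k = i then 1 else (0::real)"
  shows "(\<Sum>k<d. \<Sum>l<d. v k * v l * H k l) = H i i" "(\<Sum>k<d. (v k)\<^sup>2) = 1"
proof -
  have *: "(\<Sum>k<d. v k * g k) = g i" for g
    using assms(1) by (simp add: v_def if_distrib[of "\<lambda>x. x * _"] cong: if_cong)
  have "(\<Sum>k<d. \<Sum>l<d. v k * v l * H k l) = (\<Sum>k<d. v k * (\<Sum>l<d. v l * H k l))"
    by (simp add: sum_distrib_left mult_ac)
  then show "(\<Sum>k<d. \<Sum>l<d. v k * v l * H k l) = H i i" unfolding * .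
  show "(\<Sum>k<d. (v k)\<^sup>2) = 1"
    using *[of v] by (simp add: power2_eq_square v_def)
qed

text \<open>
  The quadratic form at \<open>e\<^sub>i \<plusminus> e\<^sub>j\<close> is nonnegative, so by symmetry an off-diagonal entry is at most the
  mean of the two diagonal entries in absolute value.
\<close>

lemma hessian_entry_bound:
  assumes f: "C2 d f" and cvx: "convex_fun d f" and H: "hessian_le d f z c"
    and z: "z \<in> euclid d" and i: "i < d" and j: "j < d"
  shows "\<bar>partial i (partial j f) z\<bar> \<le> c"
proof -
  have diag: "0 \<le> partial k (partial k f) z" "partial k (partial k f) z \<le> c" if "k < d" for k
    using convex_fun_hessian_nonneg[OF f cvx z, of "\<lambda>l. if l = k then 1 else 0"] that
      H[unfolded hessian_le_def, rule_format, of "\<lambda>l. if l = k then 1 else 0"]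
      sum_one_index(1)[OF that, of "\<lambda>k l. partial k (partial l f) z"] sum_one_index(2)[OF that] by simp_all
  show ?thesis
  proof (cases "i = j")
    case False
    have "0 \<le> partial i (partial i f) z + b * partial i (partial j f) z + b * partial j (partial i f) z
        + b * b * partial j (partial j f) z" for b
      using convex_fun_hessian_nonneg[OF f cvx z, of "\<lambda>k. (if k = i then 1 else 0) + (if k = j then b else 0)"]
      unfolding sum_two_indices[OF i j False] by simp
    from this[of 1] this[of "-1"] diag[OF i] diag[OF j] show ?thesis
      using C2_mixed_partials[OF f i j z] by simp
  qed (use diag i in auto)
qed

section \<open>Consequences of an upper bound on the Hessian\<close>

lemma descent_along:
  assumes f: "C2 d f" and H: "\<And>z. z \<in> euclid d \<Longrightarrow> hessian_le d f z c"
    and z: "z \<in> euclid d"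
  shows "f (along d z t v) \<le> f z + t * (\<Sum>i<d. v i * partial i f z) + c / 2 * t\<^sup>2 * (\<Sum>i<d. (v i)\<^sup>2)"
proof -
  have "along d z 1 (\<lambda>i. t * v i) = along d z t v" by (simp add: along_def)
  with hessian_le_descent[OF f H z, of "\<lambda>i. t * v i"] show ?thesis
    by (simp add: power_mult_distrib mult.assoc flip: sum_distrib_left)
qed

text \<open>
  In one of the two directions \<open>v\<close> and \<open>-v\<close> the linear term of the descent inequality is
  nonpositive.
\<close>

lemma exp_neg_le_two_sided:
  assumes f: "C2 d f" and H: "\<And>z. z \<in> euclid d \<Longrightarrow> hessian_le d f z c"
    and z: "z \<in> euclid d"
  shows "exp (- f z) \<le> exp (c / 2 * (\<Sum>i<d. (v i)\<^sup>2)) *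
    (exp (- f (along d z 1 v)) + exp (- f (along d z (-1) v)))"
proof -
  let ?b = "c / 2 * (\<Sum>i<d. (v i)\<^sup>2)"
  have "f (along d z 1 v) \<le> f z + ?b \<or> f (along d z (-1) v) \<le> f z + ?b"
    using descent_along[OF f H z, of 1 v] descent_along[OF f H z, of "-1" v] by auto
  then have "exp (- f z) \<le> exp (?b + - f (along d z 1 v)) \<or> exp (- f z) \<le> exp (?b + - f (along d z (-1) v))"
    by (simp only: exp_le_cancel_iff) linarith
  then show ?thesis
    unfolding exp_add distrib_left
    by (elim disjE) (meson add_increasing add_increasing2 exp_ge_zero mult_nonneg_nonneg)+
qed

lemma descent_coordinate:
  assumes f: "C2 d f" and H: "\<And>z. z \<in> euclid d \<Longrightarrow> hessian_le d f z c"
    and z: "z \<in> euclid d" and i: "i < d"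
  shows "f (z(i := z i + t)) \<le> f z + t * partial i f z + c / 2 * t\<^sup>2"
proof -
  let ?v = "\<lambda>k. if k = i then 1 else (0::real)"
  have "along d z t ?v = z(i := z i + t)"
    using z i by (auto simp: along_def euclid_def PiE_def extensional_def)
  moreover have "(\<Sum>k<d. ?v k * partial k f z) = partial i f z"
    using i by (simp add: if_distrib[of "\<lambda>x. x * _"] cong: if_cong)
  ultimately show ?thesis
    using descent_along[OF f H z, of t ?v] sum_one_index(2)[OF i] by simp
qed

text \<open>
  With \<open>g = \<partial>\<^sub>i f z\<close> one has \<open>g\<^sup>2 \<le> 2 exp \<bar>g\<bar>\<close>, and descent by one unit against the sign of \<open>g\<close> lowers
  \<open>f\<close> by at least \<open>\<bar>g\<bar> - c / 2\<close>, which absorbs the exponential into the density at a neighbour.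
\<close>

lemma partial_sq_exp_neg_le:
  assumes f: "C2 d f" and H: "\<And>z. z \<in> euclid d \<Longrightarrow> hessian_le d f z c"
    and z: "z \<in> euclid d" and i: "i < d"
  shows "(partial i f z)\<^sup>2 * exp (- f z) \<le>
    2 * exp (c / 2) * (exp (- f (z(i := z i + 1))) + exp (- f (z(i := z i + (-1)))))"
proof -
  let ?g = "partial i f z"
  have "?g\<^sup>2 \<le> 2 * exp \<bar>?g\<bar>"
    using exp_lower_Taylor_quadratic[of "\<bar>?g\<bar>"] by simp
  then have "?g\<^sup>2 * exp (- f z) \<le> 2 * exp \<bar>?g\<bar> * exp (- f z)"
    by (intro mult_right_mono) auto
  also have "\<dots> = 2 * exp (\<bar>?g\<bar> - f z)" by (simp add: exp_diff exp_minus divide_inverse)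
  also have "exp (\<bar>?g\<bar> - f z) \<le> exp (c / 2 + - f (z(i := z i + 1))) + exp (c / 2 + - f (z(i := z i + (-1))))"
  proof (cases "?g \<ge> 0")
    case True
    then have "exp (\<bar>?g\<bar> - f z) \<le> exp (c / 2 + - f (z(i := z i + (-1))))"
      using descent_coordinate[OF f H z i, of "-1"] by simp
    then show ?thesis by (simp add: add_increasing)
  next
    case False
    then have "exp (\<bar>?g\<bar> - f z) \<le> exp (c / 2 + - f (z(i := z i + 1)))"
      using descent_coordinate[OF f H z i, of 1] by simp
    then show ?thesis by (simp add: add_increasing2)
  qed
  also have "\<dots> = exp (c / 2) * (exp (- f (z(i := z i + 1))) + exp (- f (z(i := z i + (-1)))))"
    by (simp only: exp_add distrib_left)
  finally show ?thesis by simp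
qed

text \<open>
  Moving from \<open>t\<close> to whichever of \<open>a \<plusminus> 1\<close> lies on the descending side, over a distance of at most 2,
  raises \<open>f\<close> by at most \<open>2 c\<close>. The right-hand side does not depend on \<open>t\<close>, so it can serve as a
  dominating function.
\<close>

lemma exp_neg_segment_le:
  assumes f: "C2 d f" and H: "\<And>z. z \<in> euclid d \<Longrightarrow> hessian_le d f z c"
    and z: "z \<in> euclid d" and i: "i < d" and c: "0 \<le> c" and t: "\<bar>t - a\<bar> \<le> 1"
  shows "exp (- f (z(i := t))) \<le> exp (2 * c) * (exp (- f (z(i := a - 1))) + exp (- f (z(i := a + 1))))"
proof -
  let ?g = "partial i f (z(i := t))"
  have sq: "c / 2 * s\<^sup>2 \<le> 2 * c" if "\<bar>s\<bar> \<le> 2" for s :: real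
  proof -
    have "s\<^sup>2 \<le> 2\<^sup>2" using that by (intro abs_le_square_iff[THEN iffD1]) simp
    then have "c / 2 * s\<^sup>2 \<le> c / 2 * 4" using c by (intro mult_left_mono) auto
    then show ?thesis by simp
  qed
  have D: "f (z(i := t + s)) \<le> f (z(i := t)) + s * ?g + 2 * c" if "\<bar>s\<bar> \<le> 2" for s
    using descent_coordinate[OF f H upd_in_euclid[OF z i] i, of t s] sq[OF that] by simp
  have "exp (- f (z(i := t))) \<le> exp (2 * c + - f (z(i := a - 1))) + exp (2 * c + - f (z(i := a + 1)))"
  proof (cases "?g \<ge> 0")
    case True
    have "(a - 1 - t) * ?g \<le> 0" using True t by (intro mult_nonpos_nonneg) auto
    then have "exp (- f (z(i := t))) \<le> exp (2 * c + - f (z(i := a - 1)))"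
      using D[of "a - 1 - t"] t by (simp add: abs_le_iff)
    then show ?thesis by (simp add: add_increasing2)
  next
    case False
    have "(a + 1 - t) * ?g \<le> 0" using False t by (intro mult_nonneg_nonpos) auto
    then have "exp (- f (z(i := t))) \<le> exp (2 * c + - f (z(i := a + 1)))"
      using D[of "a + 1 - t"] t by (simp add: abs_le_iff)
    then show ?thesis by (simp add: add_increasing)
  qed
  then show ?thesis by (simp only: exp_add distrib_left)
qed

section \<open>Marginal densities\<close>

lemma
  assumes p: "prob_density (nx + ny) p"
  shows AE_marg_nn: "AE y in leb ny. (\<integral>\<^sup>+ x. ennreal (p (joinp nx ny x y)) \<partial>leb nx) = ennreal (marg nx ny p y)"
    and AE_slice_integrable: "AE y in leb ny. integrable (leb nx) (\<lambda>x. p (joinp nx ny x y))"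
    and marg_measurable: "marg nx ny p \<in> borel_measurable (leb ny)"
proof -
  interpret X: sigma_finite_measure "leb nx" by (rule sigma_finite_leb)
  have p_meas: "p \<in> borel_measurable (leb (nx + ny))"
    using p by (simp add: prob_density_def)
  note [measurable] = p_meas
  have "(\<lambda>(y, x). joinp nx ny x y) \<in> leb ny \<Otimes>\<^sub>M leb nx \<rightarrow>\<^sub>M leb (nx + ny)"
    using measurable_compose[OF measurable_pair_swap' measurable_joinp] by (simp add: split_beta')
  from measurable_compose[OF this p_meas]
  have [measurable]: "(\<lambda>(y, x). p (joinp nx ny x y)) \<in> borel_measurable (leb ny \<Otimes>\<^sub>M leb nx)"
    by (simp add: split_beta')
  show "marg nx ny p \<in> borel_measurable (leb ny)"
    unfolding marg_def[abs_def] by measurable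
  have "(\<integral>\<^sup>+ y. \<integral>\<^sup>+ x. ennreal (p (joinp nx ny x y)) \<partial>leb nx \<partial>leb ny) = 1"
    using nn_integral_leb_joinp[of "\<lambda>z. ennreal (p z)"] p by (simp add: prob_density_def)
  then have fin: "AE y in leb ny. (\<integral>\<^sup>+ x. ennreal (p (joinp nx ny x y)) \<partial>leb nx) \<noteq> \<infinity>"
    by (intro nn_integral_PInf_AE) auto
  have nonneg: "0 \<le> p (joinp nx ny x y)" for x y
    using p by (simp add: prob_density_def)
  have int: "integrable (leb nx) (\<lambda>x. p (joinp nx ny x y))"
    if "(\<integral>\<^sup>+ x. ennreal (p (joinp nx ny x y)) \<partial>leb nx) \<noteq> \<infinity>" "y \<in> space (leb ny)" for y
    using that measurable_compose[OF measurable_joinp_right p_meas]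
    by (intro integrableI_bounded) (auto simp: nonneg less_top)
  show "AE y in leb ny. integrable (leb nx) (\<lambda>x. p (joinp nx ny x y))"
    using fin AE_space by eventually_elim (rule int)
  then show "AE y in leb ny. (\<integral>\<^sup>+ x. ennreal (p (joinp nx ny x y)) \<partial>leb nx) = ennreal (marg nx ny p y)"
    by eventually_elim (simp add: marg_def nn_integral_eq_integral nonneg)
qed

text \<open>
  The density \<open>marg\<close> is a Bochner integral, which is 0 on the slices that are not
  integrable; these form a null set, so it is still the density of the projected measure.
\<close>

lemma distr_ypart_dens_measure:
  assumes p: "prob_density (nx + ny) p"
  shows "distr (dens_measure (nx + ny) p) (leb ny) (ypart nx ny) = dens_measure ny (marg nx ny p)"
proof (rule measure_eqI)
  fix A assume "A \<in> sets (distr (dens_measure (nx + ny) p) (leb ny) (ypart nx ny))"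
  then have A [measurable]: "A \<in> sets (leb ny)" by simp
  have [measurable]: "p \<in> borel_measurable (leb (nx + ny))"
    using p by (simp add: prob_density_def)
  note [measurable] = marg_measurable[OF p]
  have pre [measurable]: "ypart nx ny -` A \<inter> euclid (nx + ny) \<in> sets (leb (nx + ny))"
    using measurable_sets[OF measurable_ypart A] by simp
  have "emeasure (distr (dens_measure (nx + ny) p) (leb ny) (ypart nx ny)) A
      = (\<integral>\<^sup>+ z. ennreal (p z) * indicator (ypart nx ny -` A \<inter> euclid (nx + ny)) z \<partial>leb (nx + ny))"
    by (simp add: dens_measure_def emeasure_distr emeasure_density)
  also have "\<dots> = (\<integral>\<^sup>+ y. \<integral>\<^sup>+ x. ennreal (p (joinp nx ny x y)) *
      indicator (ypart nx ny -` A \<inter> euclid (nx + ny)) (joinp nx ny x y) \<partial>leb nx \<partial>leb ny)"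
    by (rule nn_integral_leb_joinp) measurable
  also have "\<dots> = (\<integral>\<^sup>+ y. ennreal (marg nx ny p y) * indicator A y \<partial>leb ny)"
  proof (rule nn_integral_cong_AE)
    show "AE y in leb ny. (\<integral>\<^sup>+ x. ennreal (p (joinp nx ny x y)) *
        indicator (ypart nx ny -` A \<inter> euclid (nx + ny)) (joinp nx ny x y) \<partial>leb nx)
      = ennreal (marg nx ny p y) * indicator A y"
      using AE_marg_nn[OF p] AE_space
    proof eventually_elim
      case (elim y)
      then have "indicator (ypart nx ny -` A \<inter> euclid (nx + ny)) (joinp nx ny x y) = (indicator A y :: ennreal)" for x
        by (simp add: indicator_def)
      with elim show ?case by (cases "y \<in> A") simp_all
    qed
  qed
  also have "\<dots> = emeasure (dens_measure ny (marg nx ny p)) A"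
    by (simp add: dens_measure_def emeasure_density)
  finally show "emeasure (distr (dens_measure (nx + ny) p) (leb ny) (ypart nx ny)) A
      = emeasure (dens_measure ny (marg nx ny p)) A" .
qed (simp add: dens_measure_def)

lemma prob_density_prob_space:
  assumes "prob_density d p"
  shows "prob_space (dens_measure d p)"
proof (rule prob_spaceI)
  show "emeasure (dens_measure d p) (space (dens_measure d p)) = 1"
  proof -
    have "emeasure (dens_measure d p) (space (dens_measure d p))
        = (\<integral>\<^sup>+ z. ennreal (p z) * indicator (space (leb d)) z \<partial>leb d)"
      using assms unfolding dens_measure_def prob_density_def
      by (subst emeasure_density) (auto simp del: space_leb simp: space_density)
    also have "\<dots> = (\<integral>\<^sup>+ z. ennreal (p z) \<partial>leb d)"
      by (rule nn_integral_cong) simp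
    finally show ?thesis using assms by (simp add: prob_density_def)
  qed
qed

lemma prob_density_marg:
  assumes p: "prob_density (nx + ny) p"
  shows "prob_density ny (marg nx ny p)"
  unfolding prob_density_def
proof (intro conjI ballI)
  show "marg nx ny p \<in> borel_measurable (leb ny)" by (rule marg_measurable[OF p])
  show "0 \<le> marg nx ny p y" for y
    using p unfolding marg_def by (intro Bochner_Integration.integral_nonneg) (simp add: prob_density_def)
  have [measurable]: "p \<in> borel_measurable (leb (nx + ny))"
    using p by (simp add: prob_density_def)
  have "(\<integral>\<^sup>+ y. ennreal (marg nx ny p y) \<partial>leb ny)
      = (\<integral>\<^sup>+ y. \<integral>\<^sup>+ x. ennreal (p (joinp nx ny x y)) \<partial>leb nx \<partial>leb ny)"
    by (rule nn_integral_cong_AE) (use AE_marg_nn[OF p] in \<open>eventually_elim, simp\<close>)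
  also have "\<dots> = 1"
    using nn_integral_leb_joinp[of "\<lambda>z. ennreal (p z)"] p by (simp add: prob_density_def)
  finally show "(\<integral>\<^sup>+ y. ennreal (marg nx ny p y) \<partial>leb ny) = 1" .
qed

section \<open>The isoperimetric constant of a marginal\<close>

lemma measure_dens_measure_marg:
  assumes p: "prob_density (nx + ny) p" and A: "A \<in> sets (leb ny)"
  shows "measure (dens_measure ny (marg nx ny p)) A
    = measure (dens_measure (nx + ny) p) (ypart nx ny -` A \<inter> euclid (nx + ny))"
proof -
  have "measure (distr (dens_measure (nx + ny) p) (leb ny) (ypart nx ny)) A
      = measure (dens_measure (nx + ny) p) (ypart nx ny -` A \<inter> space (dens_measure (nx + ny) p))"
    by (rule measure_distr) (use A in \<open>simp_all add: dens_measure_def\<close>)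
  then show ?thesis
    unfolding distr_ypart_dens_measure[OF p] by (simp add: dens_measure_def)
qed

lemma euclid_dist_ypart_le: "euclid_dist ny (ypart nx ny z) (ypart nx ny u) \<le> euclid_dist (nx + ny) z u"
proof -
  have "(\<Sum>i<ny. (ypart nx ny z i - ypart nx ny u i)\<^sup>2) = (\<Sum>i\<in>{nx..<nx + ny}. (z i - u i)\<^sup>2)"
    by (rule sum.reindex_bij_witness[of _ "\<lambda>i. i - nx" "\<lambda>i. nx + i"]) (auto simp: ypart_def)
  also have "\<dots> \<le> (\<Sum>i<nx + ny. (z i - u i)\<^sup>2)"
    by (rule sum_mono2) auto
  finally show ?thesis
    by (simp add: euclid_dist_def L2_set_def)
qed

lemma set_distance_bdd: "bdd_below {euclid_dist d z u | z u. z \<in> A \<and> u \<in> B}"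
  by (rule bdd_belowI[of _ 0]) (auto simp: euclid_dist_def)

lemma ypart_vimage_nonempty:
  assumes "A \<subseteq> euclid ny" "A \<noteq> {}"
  shows "ypart nx ny -` A \<inter> euclid (nx + ny) \<noteq> {}"
proof -
  obtain y where "y \<in> A" "y \<in> euclid ny" using assms by auto
  then have "joinp nx ny y y \<in> ypart nx ny -` A \<inter> euclid (nx + ny)" by simp
  then show ?thesis by blast
qed

lemma set_distance_ypart_vimage:
  assumes "A \<subseteq> euclid ny" "A \<noteq> {}" "B \<subseteq> euclid ny" "B \<noteq> {}"
  shows "set_distance ny A B \<le>
    set_distance (nx + ny) (ypart nx ny -` A \<inter> euclid (nx + ny)) (ypart nx ny -` B \<inter> euclid (nx + ny))"
  unfolding set_distance_def[of "nx + ny"]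
proof (rule cInf_greatest)
  show "{euclid_dist (nx + ny) z u |z u. z \<in> ypart nx ny -` A \<inter> euclid (nx + ny) \<and>
      u \<in> ypart nx ny -` B \<inter> euclid (nx + ny)} \<noteq> {}"
    using ypart_vimage_nonempty[OF assms(1,2)] ypart_vimage_nonempty[OF assms(3,4)] by blast
  fix r assume "r \<in> {euclid_dist (nx + ny) z u |z u. z \<in> ypart nx ny -` A \<inter> euclid (nx + ny) \<and>
      u \<in> ypart nx ny -` B \<inter> euclid (nx + ny)}"
  then obtain z u where zu: "r = euclid_dist (nx + ny) z u" "ypart nx ny z \<in> A" "ypart nx ny u \<in> B" by auto
  have "set_distance ny A B \<le> euclid_dist ny (ypart nx ny z) (ypart nx ny u)"
    unfolding set_distance_def using zu by (intro cInf_lower set_distance_bdd) auto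
  also have "\<dots> \<le> r" unfolding zu(1) by (rule euclid_dist_ypart_le)
  finally show "set_distance ny A B \<le> r" .
qed

lemma isoperimetricD:
  assumes "isoperimetric d p c" "S1 \<in> sets (leb d)" "S2 \<in> sets (leb d)" "S3 \<in> sets (leb d)"
    "S1 \<union> S2 \<union> S3 = euclid d" "S1 \<inter> S2 = {}" "S1 \<inter> S3 = {}" "S2 \<inter> S3 = {}" "S1 \<noteq> {}" "S2 \<noteq> {}"
  shows "c * set_distance d S1 S2 * measure (dens_measure d p) S1 * measure (dens_measure d p) S2
    \<le> measure (dens_measure d p) S3"
  using assms by (simp add: isoperimetric_def)

lemma isoperimetric_marg:
  assumes p: "prob_density (nx + ny) p" and iso: "isoperimetric (nx + ny) p c"
  shows "isoperimetric ny (marg nx ny p) c"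
  unfolding isoperimetric_def
proof (intro conjI ballI impI)
  show "0 < c" using iso by (simp add: isoperimetric_def)
  fix S1 S2 S3
  assume S: "S1 \<in> sets (leb ny)" "S2 \<in> sets (leb ny)" "S3 \<in> sets (leb ny)"
    and part: "S1 \<union> S2 \<union> S3 = euclid ny \<and> S1 \<inter> S2 = {} \<and> S1 \<inter> S3 = {} \<and> S2 \<inter> S3 = {} \<and> S1 \<noteq> {} \<and> S2 \<noteq> {}"
  let ?pre = "\<lambda>S. ypart nx ny -` S \<inter> euclid (nx + ny)"
  have ne: "S1 \<subseteq> euclid ny" "S1 \<noteq> {}" "S2 \<subseteq> euclid ny" "S2 \<noteq> {}" using part by auto
  have pre: "?pre A \<in> sets (leb (nx + ny))" if "A \<in> sets (leb ny)" for A
    using measurable_sets[OF measurable_ypart that] by simp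
  have "?pre S1 \<union> ?pre S2 \<union> ?pre S3 = ?pre (S1 \<union> S2 \<union> S3)" by auto
  then have cover: "?pre S1 \<union> ?pre S2 \<union> ?pre S3 = euclid (nx + ny)" using part by auto
  have disj: "?pre S1 \<inter> ?pre S2 = {}" "?pre S1 \<inter> ?pre S3 = {}" "?pre S2 \<inter> ?pre S3 = {}"
    using part by auto
  have "c * set_distance (nx + ny) (?pre S1) (?pre S2) * measure (dens_measure (nx + ny) p) (?pre S1) *
      measure (dens_measure (nx + ny) p) (?pre S2) \<le> measure (dens_measure (nx + ny) p) (?pre S3)"
    by (rule isoperimetricD[OF iso pre[OF S(1)] pre[OF S(2)] pre[OF S(3)] cover disj
          ypart_vimage_nonempty[OF ne(1,2)] ypart_vimage_nonempty[OF ne(3,4)]])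
  moreover have "c * set_distance ny S1 S2 * measure (dens_measure (nx + ny) p) (?pre S1) *
      measure (dens_measure (nx + ny) p) (?pre S2) \<le> c * set_distance (nx + ny) (?pre S1) (?pre S2) *
      measure (dens_measure (nx + ny) p) (?pre S1) * measure (dens_measure (nx + ny) p) (?pre S2)"
    using set_distance_ypart_vimage[OF ne] \<open>0 < c\<close> by (intro mult_right_mono mult_left_mono) auto
  ultimately show "c * set_distance ny S1 S2 * measure (dens_measure ny (marg nx ny p)) S1 *
      measure (dens_measure ny (marg nx ny p)) S2 \<le> measure (dens_measure ny (marg nx ny p)) S3"
    unfolding measure_dens_measure_marg[OF p S(1)] measure_dens_measure_marg[OF p S(2)]
      measure_dens_measure_marg[OF p S(3)] by linarith
qed

lemma isoper_const_marg:
  assumes "prob_density (nx + ny) p"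
  shows "isoper_const (nx + ny) p \<le> isoper_const ny (marg nx ny p)"
  unfolding isoper_const_def using isoperimetric_marg[OF assms]
  by (intro Sup_subset_mono) auto

lemma measure_dens_measure_pos:
  assumes p: "prob_density d p" and pos: "\<And>z. z \<in> euclid d \<Longrightarrow> 0 < p z"
    and A: "A \<in> sets (leb d)" and box: "Pi\<^sub>E {..<d} (\<lambda>i. {a i..a i + 1 :: real}) \<subseteq> A"
  shows "0 < measure (dens_measure d p) A"
proof -
  interpret prob_space "dens_measure d p" by (rule prob_density_prob_space[OF p])
  have "prob A \<noteq> 0"
  proof
    assume "prob A = 0"
    then have "emeasure (dens_measure d p) A = 0" by (simp add: emeasure_eq_measure)
    then have "(\<integral>\<^sup>+ z. ennreal (p z) * indicator A z \<partial>leb d) = 0"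
      using p A unfolding dens_measure_def by (subst (asm) emeasure_density) (auto simp: prob_density_def)
    then have "AE z in leb d. ennreal (p z) * indicator A z = 0"
      using p A by (subst (asm) nn_integral_0_iff_AE) (auto simp: prob_density_def)
    then have "AE z in leb d. z \<notin> A"
      using AE_space by eventually_elim (use pos in \<open>force simp: indicator_def ennreal_eq_0_iff split: if_splits\<close>)
    then have "emeasure (leb d) A = 0"
      using A by (subst (asm) AE_iff_measurable[OF A]) (use sets.sets_into_space[OF A] in auto)
    then show False
      using emeasure_PiM_lborel_pos[of "{..<d}" A a] A box by (simp add: leb_def)
  qed
  then show ?thesis by (simp add: zero_less_measure_iff)
qed

text \<open>
  For two half-spaces at distance at least one, any isoperimetric constant \<open>c\<close> satisfies
  \<open>c P(S1) P(S2) \<le> P(S3) \<le> 1\<close>.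
\<close>

lemma isoper_const_finite:
  assumes d: "1 \<le> d" and p: "prob_density d p" and pos: "\<And>z. z \<in> euclid d \<Longrightarrow> 0 < p z"
  shows "isoper_const d p < \<infinity>"
proof -
  interpret prob_space "dens_measure d p" by (rule prob_density_prob_space[OF p])
  define S1 where "S1 = {z \<in> euclid d. z 0 \<le> 0}"
  define S2 where "S2 = {z \<in> euclid d. 1 \<le> z 0}"
  define S3 where "S3 = {z \<in> euclid d. 0 < z 0 \<and> z 0 < 1}"
  have coord: "(\<lambda>z. z 0) \<in> borel_measurable (leb d)"
    using d measurable_component_singleton[of 0 "{..<d}" "\<lambda>_. lborel :: real measure"]
    by (simp add: leb_def)
  have S1: "S1 \<in> sets (leb d)" and S2: "S2 \<in> sets (leb d)" and S3: "S3 \<in> sets (leb d)"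
    using measurable_sets[OF coord, of "{..0}"] measurable_sets[OF coord, of "{1..}"]
      measurable_sets[OF coord, of "{0<..<1}"]
    by (simp_all add: S1_def S2_def S3_def vimage_def Int_def conj_ac)
  have box1: "Pi\<^sub>E {..<d} (\<lambda>_. {-1..-1 + 1}) \<subseteq> S1" and box2: "Pi\<^sub>E {..<d} (\<lambda>_. {1..1 + 1}) \<subseteq> S2"
    using d PiE_mem[of _ "{..<d}" _ 0] by (force simp: S1_def S2_def euclid_def PiE_iff)+
  have P1: "0 < prob S1" and P2: "0 < prob S2"
    using measure_dens_measure_pos[OF p pos S1 box1] measure_dens_measure_pos[OF p pos S2 box2] by auto
  have "Pi\<^sub>E {..<d} (\<lambda>_. {-1..-1 + 1 :: real}) \<noteq> {}" "Pi\<^sub>E {..<d} (\<lambda>_. {1..1 + 1 :: real}) \<noteq> {}"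
    by (auto simp: PiE_eq_empty_iff)
  then have ne: "S1 \<noteq> {}" "S2 \<noteq> {}" using box1 box2 by auto
  have dist: "1 \<le> set_distance d S1 S2"
    unfolding set_distance_def
  proof (rule cInf_greatest)
    show "{euclid_dist d z u |z u. z \<in> S1 \<and> u \<in> S2} \<noteq> {}" using ne by blast
    fix r assume "r \<in> {euclid_dist d z u |z u. z \<in> S1 \<and> u \<in> S2}"
    then obtain z u where zu: "r = euclid_dist d z u" "z 0 \<le> 0" "1 \<le> u 0" by (auto simp: S1_def S2_def)
    have "1 \<le> \<bar>z 0 - u 0\<bar>" using zu by auto
    also have "\<dots> \<le> r"
      unfolding zu(1) euclid_dist_def
      using member_le_L2_set[of "{..<d}" 0 "\<lambda>i. \<bar>z i - u i\<bar>"] d by (simp add: L2_set_def)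
    finally show "1 \<le> r" .
  qed
  have "c \<le> 1 / (prob S1 * prob S2)" if "isoperimetric d p c" for c
  proof -
    have c: "0 < c" using that by (simp add: isoperimetric_def)
    have "c * set_distance d S1 S2 * prob S1 * prob S2 \<le> prob S3"
      by (rule isoperimetricD[OF that S1 S2 S3 _ _ _ _ ne]) (auto simp: S1_def S2_def S3_def)
    moreover have "c * 1 * prob S1 * prob S2 \<le> c * set_distance d S1 S2 * prob S1 * prob S2"
      using dist c by (intro mult_right_mono mult_left_mono) auto
    ultimately have "c * (prob S1 * prob S2) \<le> 1"
      using prob_le_1[of S3] by (simp only: mult.assoc mult_1_right mult_1_left)
    then show ?thesis using P1 P2 by (simp add: pos_le_divide_eq)
  qed
  then have "isoper_const d p \<le> ereal (1 / (prob S1 * prob S2))"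
    unfolding isoper_const_def by (intro Sup_least) auto
  then show ?thesis by (rule order_le_less_trans) simp
qed

section \<open>Warm starts of a marginal\<close>

text \<open>
  The conditional density integrates to one on every slice, so projecting onto \<open>y\<close> recovers \<open>\<mu>\<close>
  even if \<open>\<mu>\<close> charges Lebesgue null sets.
\<close>

lemma distr_ypart_cond_lift:
  assumes p: "prob_density (nx + ny) p"
    and slice: "\<And>y. y \<in> euclid ny \<Longrightarrow> integrable (leb nx) (\<lambda>x. p (joinp nx ny x y))"
    and pos: "\<And>y. y \<in> euclid ny \<Longrightarrow> 0 < marg nx ny p y"
    and \<mu>: "prob_space \<mu>" and sets_\<mu>: "sets \<mu> = sets (leb ny)"
  shows "distr (cond_lift nx ny p \<mu>) (leb ny) (ypart nx ny) = \<mu>"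
proof (rule measure_eqI)
  show "sets (distr (cond_lift nx ny p \<mu>) (leb ny) (ypart nx ny)) = sets \<mu>" by (simp add: sets_\<mu>)
  fix A assume "A \<in> sets (distr (cond_lift nx ny p \<mu>) (leb ny) (ypart nx ny))"
  then have A [measurable]: "A \<in> sets (leb ny)" by simp
  interpret M: prob_space \<mu> by (rule \<mu>)
  interpret pair_sigma_finite "leb nx" \<mu>
    by (simp add: pair_sigma_finite_def sigma_finite_leb M.sigma_finite_measure_axioms)
  have space_\<mu>: "space \<mu> = euclid ny" using sets_eq_imp_space_eq[OF sets_\<mu>] by simp
  have pair: "sets (leb nx \<Otimes>\<^sub>M \<mu>) = sets (leb nx \<Otimes>\<^sub>M leb ny)"
    by (rule sets_pair_measure_cong[OF refl sets_\<mu>])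
  have p_meas: "p \<in> borel_measurable (leb (nx + ny))"
    using p by (simp add: prob_density_def)
  have nonneg: "0 \<le> p (joinp nx ny x y)" for x y
    using p by (simp add: prob_density_def)
  have J: "(\<lambda>(x, y). joinp nx ny x y) \<in> leb nx \<Otimes>\<^sub>M \<mu> \<rightarrow>\<^sub>M leb (nx + ny)"
    using measurable_joinp by (simp cong: measurable_cong_sets add: pair)
  have snd: "snd \<in> leb nx \<Otimes>\<^sub>M \<mu> \<rightarrow>\<^sub>M leb ny"
    using measurable_snd[of "leb nx" \<mu>] by (simp cong: measurable_cong_sets add: sets_\<mu>)
  have cond_meas [measurable]: "(\<lambda>(x, y). ennreal (cond nx ny p x y)) \<in> borel_measurable (leb nx \<Otimes>\<^sub>M \<mu>)"
    using measurable_compose[OF J p_meas] measurable_compose[OF snd marg_measurable[OF p]]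
    by (simp add: cond_def split_beta')
  have A_\<mu> [measurable]: "A \<in> sets \<mu>" by (simp add: sets_\<mu>)
  have "emeasure (distr (cond_lift nx ny p \<mu>) (leb ny) (ypart nx ny)) A
      = emeasure (density (leb nx \<Otimes>\<^sub>M \<mu>) (\<lambda>(x, y). ennreal (cond nx ny p x y))) (euclid nx \<times> A)"
  proof -
    have "(\<lambda>q. ypart nx ny (case q of (x, y) \<Rightarrow> joinp nx ny x y)) -` A \<inter> space (leb nx \<Otimes>\<^sub>M \<mu>) = euclid nx \<times> A"
      using sets.sets_into_space[OF A] by (auto simp: space_pair_measure space_\<mu>)
    then show ?thesis
      unfolding cond_lift_def using J measurable_compose[OF J measurable_ypart]
      by (subst distr_distr) (simp_all add: emeasure_distr comp_def)
  qed
  also have "\<dots> = (\<integral>\<^sup>+ q. (case q of (x, y) \<Rightarrow> ennreal (cond nx ny p x y)) * indicator (euclid nx \<times> A) q \<partial>(leb nx \<Otimes>\<^sub>M \<mu>))"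
    using sets.top[of "leb nx"] by (intro emeasure_density cond_meas) auto
  also have "\<dots> = (\<integral>\<^sup>+ q. ennreal (cond nx ny p (fst q) (snd q)) * indicator A (snd q) \<partial>(leb nx \<Otimes>\<^sub>M \<mu>))"
    by (rule nn_integral_cong) (auto simp: space_pair_measure indicator_def)
  also have "\<dots> = (\<integral>\<^sup>+ y. \<integral>\<^sup>+ x. ennreal (cond nx ny p x y) * indicator A y \<partial>leb nx \<partial>\<mu>)"
    using cond_meas by (subst nn_integral_snd[symmetric]) (simp_all add: split_beta')
  also have "\<dots> = (\<integral>\<^sup>+ y. indicator A y \<partial>\<mu>)"
  proof (rule nn_integral_cong)
    fix y assume "y \<in> space \<mu>"
    then have y: "y \<in> euclid ny" by (simp add: space_\<mu>)
    have "(\<integral>\<^sup>+ x. ennreal (cond nx ny p x y) \<partial>leb nx) = ennreal (\<integral>x. cond nx ny p x y \<partial>leb nx)"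
      unfolding cond_def using slice[OF y] pos[OF y] nonneg
      by (intro nn_integral_eq_integral) (auto intro!: divide_nonneg_nonneg less_imp_le)
    also have "(\<integral>x. cond nx ny p x y \<partial>leb nx) = 1"
      unfolding cond_def using pos[OF y] by (simp add: marg_def)
    finally show "(\<integral>\<^sup>+ x. ennreal (cond nx ny p x y) * indicator A y \<partial>leb nx) = indicator A y"
      by (cases "y \<in> A") simp_all
  qed
  also have "\<dots> = emeasure \<mu> A" by simp
  finally show "emeasure (distr (cond_lift nx ny p \<mu>) (leb ny) (ypart nx ny)) A = emeasure \<mu> A" .
qed

lemma AE_leb_joinp:
  assumes "AE z in leb (nx + ny). P z"
  shows "AE y in leb ny. AE x in leb nx. P (joinp nx ny x y)"
proof -
  interpret X: sigma_finite_measure "leb nx" by (rule sigma_finite_leb)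
  interpret pair_sigma_finite "leb nx" "leb ny"
    by (simp add: pair_sigma_finite_def sigma_finite_leb)
  have "AE q in leb nx \<Otimes>\<^sub>M leb ny. P (case q of (x, y) \<Rightarrow> joinp nx ny x y)"
    by (rule AE_distrD[OF measurable_joinp]) (subst distr_joinp, rule assms)
  then have "AE q in distr (leb ny \<Otimes>\<^sub>M leb nx) (leb nx \<Otimes>\<^sub>M leb ny) (\<lambda>(x, y). (y, x)).
      P (case q of (x, y) \<Rightarrow> joinp nx ny x y)"
    by (subst distr_pair_swap[symmetric])
  from AE_distrD[OF measurable_pair_swap' this]
  have "AE q in leb ny \<Otimes>\<^sub>M leb nx. P (joinp nx ny (snd q) (fst q))"
    by (simp add: split_beta')
  from pair_sigma_finite.AE_pair[OF _ this] show ?thesis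
    by (simp add: pair_sigma_finite_def sigma_finite_leb)
qed

lemma warm_with_marg:
  assumes p: "prob_density (nx + ny) p"
    and slice: "\<And>y. y \<in> euclid ny \<Longrightarrow> integrable (leb nx) (\<lambda>x. p (joinp nx ny x y))"
    and pos: "\<And>y. y \<in> euclid ny \<Longrightarrow> 0 < marg nx ny p y"
    and \<mu>: "prob_space \<mu>" and sets_\<mu>: "sets \<mu> = sets (leb ny)"
    and warm: "warm_with (nx + ny) (cond_lift nx ny p \<mu>) p b"
  shows "warm_with ny \<mu> (marg nx ny p) b"
proof -
  obtain p0 where b: "1 \<le> b" and p0: "prob_density (nx + ny) p0"
    and P0: "cond_lift nx ny p \<mu> = dens_measure (nx + ny) p0" and le: "AE z in leb (nx + ny). p0 z \<le> b * p z"
    using warm by (auto simp: warm_with_def)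
  have "\<mu> = dens_measure ny (marg nx ny p0)"
    using distr_ypart_cond_lift[OF p slice pos \<mu> sets_\<mu>] distr_ypart_dens_measure[OF p0] P0 by simp
  moreover have "AE y in leb ny. marg nx ny p0 y \<le> b * marg nx ny p y"
    using AE_leb_joinp[OF le] AE_slice_integrable[OF p0] AE_space
  proof eventually_elim
    case (elim y)
    then have "(\<integral>x. p0 (joinp nx ny x y) \<partial>leb nx) \<le> (\<integral>x. b * p (joinp nx ny x y) \<partial>leb nx)"
      using slice[of y] by (intro integral_mono_AE) auto
    then show ?case by (simp add: marg_def)
  qed
  ultimately show ?thesis
    using b prob_density_marg[OF p0] by (auto simp: warm_with_def)
qed

section \<open>Dominated differentiation and divergent integrals\<close>

text \<open>
  The mean value theorem bounds the difference quotients by \<open>w\<close>, so that they converge under the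
  integral by dominated convergence.
\<close>

lemma has_real_derivative_integral_dominated:
  fixes h h' :: "'a \<Rightarrow> real \<Rightarrow> real"
  assumes deriv: "\<And>x t. x \<in> space M \<Longrightarrow> \<bar>t - a\<bar> \<le> 1 \<Longrightarrow> (h x has_real_derivative h' x t) (at t)"
    and bound: "\<And>x t. x \<in> space M \<Longrightarrow> \<bar>t - a\<bar> \<le> 1 \<Longrightarrow> \<bar>h' x t\<bar> \<le> w x"
    and w: "integrable M w"
    and int: "\<And>t. \<bar>t - a\<bar> \<le> 1 \<Longrightarrow> integrable M (\<lambda>x. h x t)"
    and meas: "(\<lambda>x. h' x a) \<in> borel_measurable M"
  shows "((\<lambda>t. \<integral>x. h x t \<partial>M) has_real_derivative (\<integral>x. h' x a \<partial>M)) (at a)"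
  unfolding has_field_derivative_iff tendsto_at_iff_sequentially
proof safe
  fix X :: "nat \<Rightarrow> real" assume X: "\<forall>n. X n \<in> UNIV - {a}" and lim: "X \<longlonglongrightarrow> a"
  then obtain N where N: "\<And>n. n \<ge> N \<Longrightarrow> \<bar>X n - a\<bar> \<le> 1"
    by (metis LIMSEQ_def dist_real_def less_imp_le zero_less_one)
  have ne: "X n \<noteq> a" for n using X by auto
  have "(\<lambda>n. \<integral>x. (h x (X (n + N)) - h x a) / (X (n + N) - a) \<partial>M) \<longlonglongrightarrow> (\<integral>x. h' x a \<partial>M)"
  proof (rule integral_dominated_convergence[OF meas _ w])
    fix n
    have n: "\<bar>X (n + N) - a\<bar> \<le> 1" using N by simp
    show "(\<lambda>x. (h x (X (n + N)) - h x a) / (X (n + N) - a)) \<in> borel_measurable M"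
      using int[OF n] int[of a] by (auto dest!: borel_measurable_integrable)
    show "AE x in M. norm ((h x (X (n + N)) - h x a) / (X (n + N) - a)) \<le> w x"
    proof (rule AE_I2)
      fix x assume x: "x \<in> space M"
      obtain z where "\<bar>z - a\<bar> \<le> 1" "h x (X (n + N)) - h x a = (X (n + N) - a) * h' x z"
      proof (cases "X (n + N) < a")
        case True
        then obtain z where "X (n + N) < z" "z < a" "h x a - h x (X (n + N)) = (a - X (n + N)) * h' x z"
          using MVT2[of "X (n + N)" a "h x" "h' x"] deriv[OF x] n by auto
        with that[of z] n show ?thesis by (auto simp: algebra_simps)
      next
        case False
        then have "a < X (n + N)" using ne[of "n + N"] by simp
        then obtain z where "a < z" "z < X (n + N)" "h x (X (n + N)) - h x a = (X (n + N) - a) * h' x z"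
          using MVT2[of a "X (n + N)" "h x" "h' x"] deriv[OF x] n by auto
        with that[of z] n show ?thesis by auto
      qed
      then show "norm ((h x (X (n + N)) - h x a) / (X (n + N) - a)) \<le> w x"
        using bound[OF x, of z] ne[of "n + N"] by simp
    qed
  next
    show "AE x in M. (\<lambda>n. (h x (X (n + N)) - h x a) / (X (n + N) - a)) \<longlonglongrightarrow> h' x a"
    proof (rule AE_I2)
      fix x assume x: "x \<in> space M"
      have "((\<lambda>t. (h x t - h x a) / (t - a)) \<longlongrightarrow> h' x a) (at a)"
        using deriv[OF x, of a] by (simp add: has_field_derivative_iff)
      then have "(\<lambda>n. (h x (X n) - h x a) / (X n - a)) \<longlonglongrightarrow> h' x a"
        using X lim unfolding tendsto_at_iff_sequentially comp_def by auto
      then show "(\<lambda>n. (h x (X (n + N)) - h x a) / (X (n + N) - a)) \<longlonglongrightarrow> h' x a"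
        by (rule LIMSEQ_ignore_initial_segment)
    qed
  qed
  also have "(\<lambda>n. \<integral>x. (h x (X (n + N)) - h x a) / (X (n + N) - a) \<partial>M)
      = (\<lambda>n. ((\<integral>x. h x (X (n + N)) \<partial>M) - (\<integral>x. h x a \<partial>M)) / (X (n + N) - a))"
    using int[of a] int[OF N] by simp
  finally show "((\<lambda>t. ((\<integral>x. h x t \<partial>M) - (\<integral>x. h x a \<partial>M)) / (t - a)) \<circ> X) \<longlonglongrightarrow> (\<integral>x. h' x a \<partial>M)"
    by (auto simp: comp_def intro: LIMSEQ_offset)
qed

lemma abs_mult_exp_le: "\<bar>u * exp b\<bar> \<le> (1 + u\<^sup>2) * exp (b::real)"
proof -
  have "0 \<le> (\<bar>u\<bar> - 1)\<^sup>2 + u\<^sup>2 + 1" by simp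
  then have "\<bar>u\<bar> \<le> 1 + u\<^sup>2" by (simp add: power2_eq_square algebra_simps)
  then have "\<bar>u\<bar> * exp b \<le> (1 + u\<^sup>2) * exp b" by (rule mult_right_mono) simp
  then show ?thesis by (simp add: abs_mult)
qed

lemma abs_mult_le_sum_sq: "\<bar>u * v\<bar> \<le> u\<^sup>2 + (v::real)\<^sup>2"
proof -
  have "0 \<le> (\<bar>u\<bar> - \<bar>v\<bar>)\<^sup>2 + u\<^sup>2 + v\<^sup>2" by simp
  then show ?thesis by (simp add: power2_eq_square algebra_simps abs_mult)
qed

lemma integral_double_sum:
  fixes F :: "nat \<Rightarrow> nat \<Rightarrow> 'a \<Rightarrow> real"
  assumes "\<And>i j. i < n \<Longrightarrow> j < n \<Longrightarrow> integrable M (F i j)"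
  shows "(\<integral>x. (\<Sum>i<n. \<Sum>j<n. F i j x) \<partial>M) = (\<Sum>i<n. \<Sum>j<n. \<integral>x. F i j x \<partial>M)"
  using assms by (subst Bochner_Integration.integral_sum)
    (auto intro!: Bochner_Integration.integrable_sum sum.cong Bochner_Integration.integral_sum)

lemma emeasure_lborel_long_intervals:
  assumes A: "A \<in> sets borel" and long: "\<And>n :: nat. \<exists>a :: real. {a..a + real n} \<subseteq> A"
  shows "emeasure lborel A = \<infinity>"
proof -
  have "of_nat n \<le> emeasure lborel A" for n :: nat
  proof -
    obtain a where a: "{a..a + real n} \<subseteq> A" using long by blast
    have "(of_nat n :: ennreal) = emeasure lborel {a..a + real n}"
      by (simp add: ennreal_of_nat_eq_real_of_nat)
    also have "\<dots> \<le> emeasure lborel A" using a A by (intro emeasure_mono) auto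
    finally show ?thesis .
  qed
  then have "(SUP n. of_nat n) \<le> emeasure lborel A" by (intro SUP_least)
  then show ?thesis by (simp add: ennreal_SUP_of_nat_eq_top top_unique)
qed

text \<open>
  A concave \<open>f\<close> stays below \<open>f 0\<close> on one of the two half-lines, where \<open>exp (- f)\<close> is then bounded away
  from zero.
\<close>

lemma log_convex_line_not_integrable:
  fixes f f' :: "real \<Rightarrow> real"
  assumes f: "\<And>t. (f has_real_derivative f' t) (at t)"
    and anti: "\<And>s t. s \<le> t \<Longrightarrow> f' t \<le> f' s"
  shows "(\<integral>\<^sup>+ t. ennreal (exp (- f t)) \<partial>lborel) = \<infinity>"
proof -
  have "\<exists>A. A \<in> sets borel \<and> emeasure lborel A = \<infinity> \<and> (\<forall>t\<in>A. f t \<le> f 0)"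
  proof (cases "f' 0 \<le> 0")
    case True
    have "f t \<le> f 0" if "0 \<le> t" for t
      by (rule DERIV_nonpos_imp_nonincreasing[OF that]) (use f anti[of 0] True in \<open>blast intro: order_trans\<close>)
    moreover have "emeasure lborel {0 :: real..} = \<infinity>"
      by (rule emeasure_lborel_long_intervals) (auto intro!: exI[of _ 0])
    ultimately show ?thesis by (intro exI[of _ "{0..}"]) auto
  next
    case False
    have "f t \<le> f 0" if "t \<le> 0" for t
    proof (rule DERIV_nonneg_imp_nondecreasing[OF that])
      fix s :: real assume "s \<le> 0"
      then show "\<exists>y. (f has_real_derivative y) (at s) \<and> 0 \<le> y"
        using f anti[of s 0] False by (intro exI[of _ "f' s"]) auto
    qed
    moreover have "emeasure lborel {..0 :: real} = \<infinity>"
      by (rule emeasure_lborel_long_intervals) (auto intro!: exI[of _ "- real _"])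
    ultimately show ?thesis by (intro exI[of _ "{..0}"]) auto
  qed
  then obtain A where A: "A \<in> sets borel" "emeasure lborel A = \<infinity>" "\<And>t. t \<in> A \<Longrightarrow> f t \<le> f 0" by blast
  have "\<infinity> = ennreal (exp (- f 0)) * emeasure lborel A"
    using A(2) by (simp add: ennreal_mult_top)
  also have "\<dots> = (\<integral>\<^sup>+ t. ennreal (exp (- f 0)) * indicator A t \<partial>lborel)"
    using A(1) by (simp add: nn_integral_cmult_indicator)
  also have "\<dots> \<le> (\<integral>\<^sup>+ t. ennreal (exp (- f t)) \<partial>lborel)"
    using A(3) by (intro nn_integral_mono) (auto simp: indicator_def intro!: ennreal_leI)
  finally show ?thesis by (simp add: top_unique)
qed

lemma smoothness_nonneg: "0 \<le> smoothness d p"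
  unfolding smoothness_def by (rule Inf_greatest) auto

section \<open>Smoothness of a marginal\<close>

text \<open>
  The constant \<open>c\<close> is any bound on the Hessian and not the smallest one: that each admissible \<open>c\<close>
  stays admissible for the marginal compares the two infima that define the smoothness constants.
\<close>

locale smooth_joint =
  fixes nx ny :: nat and V :: "point \<Rightarrow> real" and c :: real
  assumes C2_V: "C2 (nx + ny) V"
    and convex_V: "convex_fun (nx + ny) V"
    and hessian_V: "\<And>z. z \<in> euclid (nx + ny) \<Longrightarrow> hessian_le (nx + ny) V z c"
    and c_nonneg: "0 \<le> c"
    and density_V: "prob_density (nx + ny) (\<lambda>z. exp (- V z))"
begin

abbreviation w :: "point \<Rightarrow> point \<Rightarrow> real" where
  "w x y \<equiv> exp (- V (joinp nx ny x y))"

abbreviation g :: "nat \<Rightarrow> point \<Rightarrow> point \<Rightarrow> real" where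
  "g j x y \<equiv> partial (nx + j) V (joinp nx ny x y)"

abbreviation h :: "nat \<Rightarrow> nat \<Rightarrow> point \<Rightarrow> point \<Rightarrow> real" where
  "h i j x y \<equiv> partial (nx + i) (partial (nx + j) V) (joinp nx ny x y)"

abbreviation m :: "point \<Rightarrow> real" where
  "m \<equiv> marg nx ny (\<lambda>z. exp (- V z))"

lemma slice_measurable:
  assumes "y \<in> euclid ny"
  shows "(\<lambda>x. w x y) \<in> borel_measurable (leb nx)"
    and "j < ny \<Longrightarrow> (\<lambda>x. g j x y) \<in> borel_measurable (leb nx)"
    and "i < ny \<Longrightarrow> j < ny \<Longrightarrow> (\<lambda>x. h i j x y) \<in> borel_measurable (leb nx)"
proof -
  have *: "(\<lambda>x. f (joinp nx ny x y)) \<in> borel_measurable (leb nx)" if "C1 (nx + ny) f" for f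
    using that measurable_compose[OF measurable_joinp_right[OF assms] borel_measurable_leb_continuous]
    by (simp add: C1_def)
  note [measurable] = *[OF C2_C1[OF C2_V]]
  show "(\<lambda>x. w x y) \<in> borel_measurable (leb nx)" by measurable
  show "(\<lambda>x. g j x y) \<in> borel_measurable (leb nx)" if "j < ny"
    using that by (intro * C2_partial[OF C2_V]) simp
  show "(\<lambda>x. h i j x y) \<in> borel_measurable (leb nx)" if "i < ny" "j < ny"
    using that C2_partial[OF C2_V, of "nx + j"]
      measurable_compose[OF measurable_joinp_right[OF assms] borel_measurable_leb_continuous]
    by (simp add: C1_def)
qed

text \<open>
  Almost every slice is integrable by Fubini's theorem. An arbitrary \<open>y\<close> is the midpoint of two such
  points \<open>u\<close> and \<open>2 y - u\<close>, and its slice is dominated by theirs.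
\<close>

lemma slice_integrable:
  assumes y: "y \<in> euclid ny"
  shows "integrable (leb nx) (\<lambda>x. w x y)"
proof -
  let ?fin = "\<lambda>y. (\<integral>\<^sup>+ x. ennreal (w x y) \<partial>leb nx) < \<infinity>"
  have fin: "AE y in leb ny. ?fin y"
    using AE_marg_nn[OF density_V] by eventually_elim simp
  let ?r = "\<lambda>u. \<lambda>i\<in>{..<ny}. 2 * y i - u i"
  have r: "?r \<in> leb ny \<rightarrow>\<^sub>M leb ny"
    unfolding leb_def by (intro measurable_restrict) measurable
  have "AE u in distr (leb ny) (leb ny) ?r. ?fin u"
    using fin by (simp only: distr_reflect_leb)
  then have "AE u in leb ny. ?fin (?r u)"
    by (rule AE_distrD[OF r])
  with fin have "AE u in leb ny. ?fin u \<and> ?fin (?r u)" by eventually_elim simp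
  then obtain u where u: "u \<in> euclid ny" "?fin u" "?fin (?r u)"
  proof -
    have "\<not> (AE u in leb ny. False)"
      using emeasure_leb_space_neq_0[of ny] AE_iff_measurable[of "euclid ny" "leb ny" "\<lambda>_. False"]
        sets.top[of "leb ny"] by simp
    then have "\<exists>u\<in>space (leb ny). ?fin u \<and> ?fin (?r u)"
    proof (rule contrapos_np)
      assume none: "\<not> (\<exists>u\<in>space (leb ny). ?fin u \<and> ?fin (?r u))"
      from \<open>AE u in leb ny. ?fin u \<and> ?fin (?r u)\<close> AE_space[of "leb ny"]
      show "AE u in leb ny. False" by eventually_elim (use none in blast)
    qed
    with that show ?thesis by auto
  qed
  define v where "v i = (if i < nx then 0 else u (i - nx) - y (i - nx))" for i
  define K where "K = exp (c / 2 * (\<Sum>i<nx + ny. (v i)\<^sup>2))"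
  have le: "w x y \<le> K * (w x u + w x (?r u))" if x: "x \<in> euclid nx" for x
  proof -
    have "along (nx + ny) (joinp nx ny x y) 1 v = joinp nx ny x u"
      "along (nx + ny) (joinp nx ny x y) (-1) v = joinp nx ny x (?r u)"
      by (auto simp: along_def joinp_def v_def fun_eq_iff restrict_def)
    with exp_neg_le_two_sided[OF C2_V hessian_V, of "joinp nx ny x y" v] show ?thesis
      by (simp add: K_def)
  qed
  have "integrable (leb nx) (\<lambda>x. w x u)" "integrable (leb nx) (\<lambda>x. w x (?r u))"
    using u measurable_space[OF r] by (auto intro!: integrableI_bounded slice_measurable)
  then have "integrable (leb nx) (\<lambda>x. K * (w x u + w x (?r u)))" by simp
  then show ?thesis
    by (rule Bochner_Integration.integrable_bound) (use le y in \<open>auto intro!: slice_measurable simp: K_def\<close>)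
qed

text \<open>
  The translation by \<open>s\<close> in coordinate \<open>j\<close> is needed because the bound on \<open>(\<partial>\<^sub>j V)\<^sup>2 exp (- V)\<close> refers to
  neighbouring slices.
\<close>

lemma slice_dominated_translate:
  assumes y: "y \<in> euclid ny" and i: "i < ny" and j: "j < ny"
  obtains b where "integrable (leb nx) b"
    "\<And>x t. \<bar>t - a\<bar> \<le> 1 \<Longrightarrow> w x ((y(i := t))(j := (y(i := t)) j + s)) \<le> b x"
proof -
  have segment: "w x (y(i := t)) \<le> exp (2 * c) * (w x (y(i := a - 1)) + w x (y(i := a + 1)))"
    if "\<bar>t - a\<bar> \<le> 1" for x t a y
    using exp_neg_segment_le[OF C2_V hessian_V _ _ c_nonneg that, of "joinp nx ny x y" "nx + i"] i
    by (simp add: joinp_upd)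
  show ?thesis
  proof (cases "i = j")
    case True
    show ?thesis
    proof (rule that)
      show "integrable (leb nx) (\<lambda>x. exp (2 * c) * (w x (y(i := (a + s) - 1)) + w x (y(i := (a + s) + 1))))"
        using y i by (intro integrable_mult_right Bochner_Integration.integrable_add slice_integrable upd_in_euclid)
      show "w x ((y(i := t))(j := (y(i := t)) j + s))
          \<le> exp (2 * c) * (w x (y(i := (a + s) - 1)) + w x (y(i := (a + s) + 1)))" if "\<bar>t - a\<bar> \<le> 1" for x t
        using segment[of "t + s" "a + s" x y] that True by simp
    qed
  next
    case False
    let ?y = "y(j := y j + s)"
    show ?thesis
    proof (rule that)
      show "integrable (leb nx) (\<lambda>x. exp (2 * c) * (w x (?y(i := a - 1)) + w x (?y(i := a + 1))))"
        using y i j by (intro integrable_mult_right Bochner_Integration.integrable_add slice_integrable upd_in_euclid)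
      show "w x ((y(i := t))(j := (y(i := t)) j + s))
          \<le> exp (2 * c) * (w x (?y(i := a - 1)) + w x (?y(i := a + 1)))" if "\<bar>t - a\<bar> \<le> 1" for x t
        using segment[OF that, of x ?y] False by (simp add: fun_upd_twist)
    qed
  qed
qed

text \<open>
  The factor \<open>1 + g\<^sup>2\<close> covers the density, its first derivative (as \<open>\<bar>g\<bar> \<le> 1 + g\<^sup>2\<close>) and, summed over two
  coordinates, the product of two first derivatives.
\<close>

lemma slice_dominated:
  assumes y: "y \<in> euclid ny" and i: "i < ny" and j: "j < ny"
  obtains b where "integrable (leb nx) b"
    "\<And>x t. \<bar>t - a\<bar> \<le> 1 \<Longrightarrow> (1 + (g j x (y(i := t)))\<^sup>2) * w x (y(i := t)) \<le> b x"
proof -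
  obtain b0 where b0: "integrable (leb nx) b0"
      "\<And>x t. \<bar>t - a\<bar> \<le> 1 \<Longrightarrow> w x ((y(i := t))(j := (y(i := t)) j + 0)) \<le> b0 x"
    using slice_dominated_translate[OF y i j] by blast
  obtain b1 where b1: "integrable (leb nx) b1"
      "\<And>x t. \<bar>t - a\<bar> \<le> 1 \<Longrightarrow> w x ((y(i := t))(j := (y(i := t)) j + 1)) \<le> b1 x"
    using slice_dominated_translate[OF y i j] by blast
  obtain b2 where b2: "integrable (leb nx) b2"
      "\<And>x t. \<bar>t - a\<bar> \<le> 1 \<Longrightarrow> w x ((y(i := t))(j := (y(i := t)) j + (-1))) \<le> b2 x"
    using slice_dominated_translate[OF y i j] by blast
  show ?thesis
  proof (rule that)
    show "integrable (leb nx) (\<lambda>x. b0 x + 2 * exp (c / 2) * (b1 x + b2 x))"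
      using b0(1) b1(1) b2(1) by simp
    show "(1 + (g j x (y(i := t)))\<^sup>2) * w x (y(i := t)) \<le> b0 x + 2 * exp (c / 2) * (b1 x + b2 x)"
      if t: "\<bar>t - a\<bar> \<le> 1" for x t
    proof -
      let ?y = "y(i := t)"
      have shift: "(joinp nx ny x ?y)(nx + j := joinp nx ny x ?y (nx + j) + s) = joinp nx ny x (?y(j := ?y j + s))" for s
        unfolding joinp_upd[OF j] using j by (simp add: joinp_def)
      have "(g j x ?y)\<^sup>2 * w x ?y \<le> 2 * exp (c / 2) * (w x (?y(j := ?y j + 1)) + w x (?y(j := ?y j + (-1))))"
        using partial_sq_exp_neg_le[OF C2_V hessian_V, of "joinp nx ny x ?y" "nx + j"] j
        unfolding shift by simp
      also have "\<dots> \<le> 2 * exp (c / 2) * (b1 x + b2 x)"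
        using b1(2)[OF t, of x] b2(2)[OF t, of x] by (intro mult_left_mono add_mono) auto
      finally show ?thesis
        using b0(2)[OF t, of x] unfolding add_0_right fun_upd_triv by (simp add: distrib_right)
    qed
  qed
qed

lemma slice_partial:
  assumes f: "C1 (nx + ny) f" and j: "j < ny"
  shows "((\<lambda>t. f (joinp nx ny x (y(j := t)))) has_real_derivative
    partial (nx + j) f (joinp nx ny x (y(j := a)))) (at a)"
  using C1_partial[OF f _ joinp_in_euclid, of "nx + j" x y a] j by (simp add: joinp_upd)

lemma integrable_score:
  assumes y: "y \<in> euclid ny" and j: "j < ny"
  shows "integrable (leb nx) (\<lambda>x. g j x y * w x y)"
proof -
  obtain b where b: "integrable (leb nx) b"
    "\<And>x t. \<bar>t - y j\<bar> \<le> 1 \<Longrightarrow> (1 + (g j x (y(j := t)))\<^sup>2) * w x (y(j := t)) \<le> b x"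
    using slice_dominated[OF y j j] by blast
  have "\<bar>g j x y * w x y\<bar> \<le> b x" for x
    using order_trans[OF abs_mult_exp_le b(2)[of "y j" x, simplified]] by simp
  then show ?thesis
    by (intro Bochner_Integration.integrable_bound[OF b(1)] AE_I2 borel_measurable_times slice_measurable y j)
      (auto intro: order_trans abs_ge_self)
qed

lemma second_derivative_dominated:
  assumes y: "y \<in> euclid ny" and i: "i < ny" and j: "j < ny"
  obtains b where "integrable (leb nx) b"
    "\<And>x t. \<bar>t - a\<bar> \<le> 1 \<Longrightarrow>
      \<bar>h i j x (y(i := t)) * w x (y(i := t))\<bar> \<le> b x \<and>
      \<bar>g i x (y(i := t)) * g j x (y(i := t)) * w x (y(i := t))\<bar> \<le> b x"
proof -
  obtain b1 where b1: "integrable (leb nx) b1"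
    "\<And>x t. \<bar>t - a\<bar> \<le> 1 \<Longrightarrow> (1 + (g i x (y(i := t)))\<^sup>2) * w x (y(i := t)) \<le> b1 x"
    using slice_dominated[OF y i i] by blast
  obtain b2 where b2: "integrable (leb nx) b2"
    "\<And>x t. \<bar>t - a\<bar> \<le> 1 \<Longrightarrow> (1 + (g j x (y(i := t)))\<^sup>2) * w x (y(i := t)) \<le> b2 x"
    using slice_dominated[OF y i j] by blast
  show ?thesis
  proof (rule that)
    show "integrable (leb nx) (\<lambda>x. (1 + c) * (b1 x + b2 x))"
      using b1(1) b2(1) by simp
    fix x t assume t: "\<bar>t - a\<bar> \<le> 1"
    let ?y = "y(i := t)"
    have w: "w x ?y \<le> b1 x" "0 \<le> b1 x" "0 \<le> b2 x"
    proof -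
      have "w x ?y \<le> (1 + u\<^sup>2) * w x ?y" for u :: real by (simp add: distrib_right)
      from order_trans[OF this b1(2)[OF t]] order_trans[OF this b2(2)[OF t]]
      show "w x ?y \<le> b1 x" "0 \<le> b1 x" "0 \<le> b2 x"
        using exp_ge_zero[of "- V (joinp nx ny x ?y)"] by linarith+
    qed
    \<comment> \<open>The common bound \<open>(1 + c) (b1 + b2)\<close> serves both products: \<open>c b1\<close> for the Hessian entry and
      \<open>b1 + b2\<close> for the product of two partial derivatives.\<close>
    have "\<bar>h i j x ?y\<bar> \<le> c"
      using hessian_entry_bound[OF C2_V convex_V hessian_V, of "joinp nx ny x ?y" "nx + i" "nx + j"] i j by simp
    then have "\<bar>h i j x ?y * w x ?y\<bar> \<le> c * b1 x"
      using w c_nonneg by (simp add: abs_mult mult_mono)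
    also have "\<dots> \<le> (1 + c) * (b1 x + b2 x)"
      using w c_nonneg by (simp add: algebra_simps)
    finally have 1: "\<bar>h i j x ?y * w x ?y\<bar> \<le> (1 + c) * (b1 x + b2 x)" .
    have "\<bar>g i x ?y * g j x ?y * w x ?y\<bar> = \<bar>g i x ?y * g j x ?y\<bar> * w x ?y"
      by (simp add: abs_mult)
    also have "\<dots> \<le> ((g i x ?y)\<^sup>2 + (g j x ?y)\<^sup>2) * w x ?y"
      by (intro mult_right_mono abs_mult_le_sum_sq) simp
    also have "\<dots> \<le> b1 x + b2 x"
      using b1(2)[OF t, of x] b2(2)[OF t, of x] exp_ge_zero[of "- V (joinp nx ny x ?y)"]
      unfolding distrib_right mult_1_left by linarith
    also have "\<dots> \<le> (1 + c) * (b1 x + b2 x)"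
      using w c_nonneg by (simp add: algebra_simps)
    finally show "\<bar>h i j x ?y * w x ?y\<bar> \<le> (1 + c) * (b1 x + b2 x) \<and>
      \<bar>g i x ?y * g j x ?y * w x ?y\<bar> \<le> (1 + c) * (b1 x + b2 x)" using 1 by simp
  qed
qed

lemma integrable_second_order:
  assumes y: "y \<in> euclid ny" and i: "i < ny" and j: "j < ny"
  shows "integrable (leb nx) (\<lambda>x. h i j x y * w x y)"
    and "integrable (leb nx) (\<lambda>x. g i x y * g j x y * w x y)"
proof -
  obtain b where b: "integrable (leb nx) b"
    "\<And>x t. \<bar>t - y i\<bar> \<le> 1 \<Longrightarrow>
      \<bar>h i j x (y(i := t)) * w x (y(i := t))\<bar> \<le> b x \<and>
      \<bar>g i x (y(i := t)) * g j x (y(i := t)) * w x (y(i := t))\<bar> \<le> b x"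
    using second_derivative_dominated[OF y i j] by blast
  have b': "\<bar>h i j x y * w x y\<bar> \<le> b x" "\<bar>g i x y * g j x y * w x y\<bar> \<le> b x" for x
    using b(2)[of "y i" x] by auto
  show "integrable (leb nx) (\<lambda>x. h i j x y * w x y)"
    by (intro Bochner_Integration.integrable_bound[OF b(1)] AE_I2 borel_measurable_times slice_measurable y i j)
      (use b'(1) in \<open>auto intro: order_trans abs_ge_self\<close>)
  show "integrable (leb nx) (\<lambda>x. g i x y * g j x y * w x y)"
    by (intro Bochner_Integration.integrable_bound[OF b(1)] AE_I2 borel_measurable_times slice_measurable y i j)
      (use b'(2) in \<open>auto intro: order_trans abs_ge_self\<close>)
qed

lemma marg_derivative:
  assumes y: "y \<in> euclid ny" and j: "j < ny"
  shows "((\<lambda>t. m (y(j := t))) has_real_derivative - (\<integral>x. g j x (y(j := a)) * w x (y(j := a)) \<partial>leb nx)) (at a)"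
proof -
  obtain b where b: "integrable (leb nx) b"
    "\<And>x t. \<bar>t - a\<bar> \<le> 1 \<Longrightarrow> (1 + (g j x (y(j := t)))\<^sup>2) * w x (y(j := t)) \<le> b x"
    using slice_dominated[OF y j j] by blast
  have "((\<lambda>t. \<integral>x. w x (y(j := t)) \<partial>leb nx) has_real_derivative
      (\<integral>x. - (g j x (y(j := a)) * w x (y(j := a))) \<partial>leb nx)) (at a)"
  proof (rule has_real_derivative_integral_dominated[OF _ _ b(1),
        where h' = "\<lambda>x t. - (g j x (y(j := t)) * w x (y(j := t)))"])
    fix x t assume t: "\<bar>t - a\<bar> \<le> 1"
    show "((\<lambda>t. w x (y(j := t))) has_real_derivative - (g j x (y(j := t)) * w x (y(j := t)))) (at t)"
      using slice_partial[OF C2_C1[OF C2_V] j, of x y t] by (auto intro!: derivative_eq_intros)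
    show "\<bar>- (g j x (y(j := t)) * w x (y(j := t)))\<bar> \<le> b x"
      using order_trans[OF abs_mult_exp_le b(2)[OF t]] unfolding abs_minus_cancel .
  next
    show "integrable (leb nx) (\<lambda>x. w x (y(j := t)))" for t
      using y j by (intro slice_integrable upd_in_euclid)
    show "(\<lambda>x. - (g j x (y(j := a)) * w x (y(j := a)))) \<in> borel_measurable (leb nx)"
      using y j by (intro borel_measurable_uminus borel_measurable_times slice_measurable upd_in_euclid)
  qed
  then show ?thesis by (simp add: marg_def)
qed

lemma score_derivative:
  assumes y: "y \<in> euclid ny" and i: "i < ny" and j: "j < ny"
  shows "((\<lambda>t. \<integral>x. g j x (y(i := t)) * w x (y(i := t)) \<partial>leb nx) has_real_derivative
    (\<integral>x. h i j x (y(i := a)) * w x (y(i := a)) \<partial>leb nx)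
      - (\<integral>x. g i x (y(i := a)) * g j x (y(i := a)) * w x (y(i := a)) \<partial>leb nx)) (at a)"
proof -
  obtain b where b: "integrable (leb nx) b"
    "\<And>x t. \<bar>t - a\<bar> \<le> 1 \<Longrightarrow>
      \<bar>h i j x (y(i := t)) * w x (y(i := t))\<bar> \<le> b x \<and>
      \<bar>g i x (y(i := t)) * g j x (y(i := t)) * w x (y(i := t))\<bar> \<le> b x"
    using second_derivative_dominated[OF y i j] by blast
  have ya: "y(i := a) \<in> euclid ny" using y i by (rule upd_in_euclid)
  have "((\<lambda>t. \<integral>x. g j x (y(i := t)) * w x (y(i := t)) \<partial>leb nx) has_real_derivative
      (\<integral>x. h i j x (y(i := a)) * w x (y(i := a)) - g i x (y(i := a)) * g j x (y(i := a)) * w x (y(i := a)) \<partial>leb nx)) (at a)"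
  proof (rule has_real_derivative_integral_dominated[where w = "\<lambda>x. 2 * b x" and
        h' = "\<lambda>x t. h i j x (y(i := t)) * w x (y(i := t)) - g i x (y(i := t)) * g j x (y(i := t)) * w x (y(i := t))"])
    fix x t assume t: "\<bar>t - a\<bar> \<le> 1"
    show "((\<lambda>t. g j x (y(i := t)) * w x (y(i := t))) has_real_derivative
        h i j x (y(i := t)) * w x (y(i := t)) - g i x (y(i := t)) * g j x (y(i := t)) * w x (y(i := t))) (at t)"
      using slice_partial[OF C2_C1[OF C2_V] i, of x y t]
        slice_partial[OF C2_partial[OF C2_V, of "nx + j"] i, of x y t] j
      by (auto intro!: derivative_eq_intros)
    show "\<bar>h i j x (y(i := t)) * w x (y(i := t)) - g i x (y(i := t)) * g j x (y(i := t)) * w x (y(i := t))\<bar> \<le> 2 * b x"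
      using b(2)[OF t, of x] by linarith
  next
    show "integrable (leb nx) (\<lambda>x. 2 * b x)" using b(1) by simp
    show "integrable (leb nx) (\<lambda>x. g j x (y(i := t)) * w x (y(i := t)))" for t
      using y i j by (intro integrable_score upd_in_euclid)
    show "(\<lambda>x. h i j x (y(i := a)) * w x (y(i := a)) - g i x (y(i := a)) * g j x (y(i := a)) * w x (y(i := a)))
        \<in> borel_measurable (leb nx)"
      by (intro borel_measurable_diff borel_measurable_times slice_measurable ya i j)
  qed
  then show ?thesis
    using integrable_second_order[OF ya i j] by simp
qed

lemma marg_pos:
  assumes y: "y \<in> euclid ny"
  shows "0 < m y"
proof -
  have "m y \<ge> 0" unfolding marg_def by simp
  moreover have "m y \<noteq> 0"
  proof
    assume "m y = 0"
    then have "AE x in leb nx. w x y = 0"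
      using integral_nonneg_eq_0_iff_AE[OF slice_integrable[OF y]] by (simp add: marg_def)
    then have "emeasure (leb nx) (euclid nx) = 0"
      using AE_iff_measurable[of "euclid nx" "leb nx" "\<lambda>_. False"] sets.top[of "leb nx"] by simp
    then show False using emeasure_leb_space_neq_0 by simp
  qed
  ultimately show ?thesis by simp
qed

lemma potential_marg_derivative:
  assumes y: "y \<in> euclid ny" and j: "j < ny"
  shows "((\<lambda>t. potential m (y(j := t))) has_real_derivative
    (\<integral>x. g j x (y(j := a)) * w x (y(j := a)) \<partial>leb nx) / m (y(j := a))) (at a)"
  unfolding potential_def
  using marg_derivative[OF y j, of a] marg_pos[OF upd_in_euclid[OF y j, of a]]
  by (auto intro!: derivative_eq_intros simp: field_simps)

lemma partial_potential_marg:
  assumes y: "y \<in> euclid ny" and j: "j < ny"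
  shows "partial j (potential m) y = (\<integral>x. g j x y * w x y \<partial>leb nx) / m y"
  using DERIV_imp_deriv[OF potential_marg_derivative[OF y j, of "y j"]]
  by (simp add: partial_def line_def[abs_def])

lemma partial_potential_marg_derivative:
  assumes y: "y \<in> euclid ny" and i: "i < ny" and j: "j < ny"
  shows "((\<lambda>t. partial j (potential m) (y(i := t))) has_real_derivative
    (\<integral>x. h i j x (y(i := a)) * w x (y(i := a)) \<partial>leb nx) / m (y(i := a))
    - (\<integral>x. g i x (y(i := a)) * g j x (y(i := a)) * w x (y(i := a)) \<partial>leb nx) / m (y(i := a))
    + (\<integral>x. g i x (y(i := a)) * w x (y(i := a)) \<partial>leb nx) * (\<integral>x. g j x (y(i := a)) * w x (y(i := a)) \<partial>leb nx)
      / (m (y(i := a)))\<^sup>2) (at a)"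
proof -
  have "(\<lambda>t. partial j (potential m) (y(i := t)))
      = (\<lambda>t. (\<integral>x. g j x (y(i := t)) * w x (y(i := t)) \<partial>leb nx) / m (y(i := t)))"
    using partial_potential_marg[OF upd_in_euclid[OF y i] j] by auto
  then show ?thesis
    using score_derivative[OF y i j, of a] marg_derivative[OF y i, of a] marg_pos[OF upd_in_euclid[OF y i, of a]]
    by (auto intro!: derivative_eq_intros simp: field_simps power2_eq_square)
qed

lemma second_partial_potential_marg:
  assumes y: "y \<in> euclid ny" and i: "i < ny" and j: "j < ny"
  shows "partial i (partial j (potential m)) y =
    (\<integral>x. h i j x y * w x y \<partial>leb nx) / m y - (\<integral>x. g i x y * g j x y * w x y \<partial>leb nx) / m y
    + (\<integral>x. g i x y * w x y \<partial>leb nx) * (\<integral>x. g j x y * w x y \<partial>leb nx) / (m y)\<^sup>2"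
  using DERIV_imp_deriv[OF partial_potential_marg_derivative[OF y i j, of "y i"]]
  by (simp add: partial_def[of i] line_def[abs_def])

lemma hessian_slice_le:
  "(\<Sum>i<ny. \<Sum>j<ny. v i * v j * h i j x y) \<le> c * (\<Sum>i<ny. (v i)\<^sup>2)"
proof -
  define u where "u k = (if k < nx then 0 else v (k - nx))" for k
  have split: "(\<Sum>k<nx + n. f k) = (\<Sum>k<n. f (nx + k))" if "\<And>k. k < nx \<Longrightarrow> f k = 0"
    for f :: "nat \<Rightarrow> real" and n
    using that by (induction n) simp_all
  have "(\<Sum>k<nx + ny. \<Sum>l<nx + ny. u k * u l * partial k (partial l V) (joinp nx ny x y))
      \<le> c * (\<Sum>k<nx + ny. (u k)\<^sup>2)"
    using hessian_V[of "joinp nx ny x y"] by (simp add: hessian_le_def)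
  then show ?thesis
    by (simp add: split u_def)
qed

text \<open>
  For \<open>X = \<nabla>\<^sub>y V \<bullet> v\<close> with conditional mean \<open>a\<close>, the pointwise bound \<open>- X\<^sup>2 \<le> a\<^sup>2 - 2 a X\<close> has conditional
  mean \<open>- a\<^sup>2\<close> on the right, which cancels the term \<open>a\<^sup>2\<close> of the Hessian formula.
\<close>

lemma hessian_le_marg:
  assumes y: "y \<in> euclid ny"
  shows "hessian_le ny (potential m) y c"
  unfolding hessian_le_def
proof
  fix v :: point
  define X where "X x = (\<Sum>i<ny. v i * g i x y)" for x
  define Q where "Q x = (\<Sum>i<ny. \<Sum>j<ny. v i * v j * h i j x y)" for x
  let ?E = "\<lambda>F. \<integral>x. F x * w x y \<partial>leb nx"
  have pos: "0 < m y" by (rule marg_pos[OF y])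
  have X_sq: "(X x)\<^sup>2 = (\<Sum>i<ny. \<Sum>j<ny. v i * v j * (g i x y * g j x y))" for x
    by (simp add: X_def power2_eq_square sum_product mult_ac)
  have int_h: "integrable (leb nx) (\<lambda>x. v i * v j * (h i j x y * w x y))"
    and int_gg: "integrable (leb nx) (\<lambda>x. v i * v j * (g i x y * g j x y * w x y))" if "i < ny" "j < ny" for i j
    using integrable_second_order[OF y that] by simp_all
  have int_g: "integrable (leb nx) (\<lambda>x. v i * (g i x y * w x y))" if "i < ny" for i
    using integrable_score[OF y that] by simp
  have Q_eq: "Q x * w x y = (\<Sum>i<ny. \<Sum>j<ny. v i * v j * (h i j x y * w x y))"
    and X_sq_eq: "(X x)\<^sup>2 * w x y = (\<Sum>i<ny. \<Sum>j<ny. v i * v j * (g i x y * g j x y * w x y))"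
    and X_eq: "X x * w x y = (\<Sum>i<ny. v i * (g i x y * w x y))" for x
    unfolding X_sq by (simp_all add: Q_def X_def sum_distrib_right mult.assoc)
  have int_Q: "integrable (leb nx) (\<lambda>x. Q x * w x y)"
    unfolding Q_eq by (intro Bochner_Integration.integrable_sum int_h) auto
  have int_XX: "integrable (leb nx) (\<lambda>x. (X x)\<^sup>2 * w x y)"
    unfolding X_sq_eq by (intro Bochner_Integration.integrable_sum int_gg) auto
  have int_X: "integrable (leb nx) (\<lambda>x. X x * w x y)"
    unfolding X_eq by (intro Bochner_Integration.integrable_sum int_g) auto
  have EQ: "?E Q = (\<Sum>i<ny. \<Sum>j<ny. v i * v j * (\<integral>x. h i j x y * w x y \<partial>leb nx))"
    unfolding Q_eq using int_h by (subst integral_double_sum) auto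
  have EXX: "?E (\<lambda>x. (X x)\<^sup>2) = (\<Sum>i<ny. \<Sum>j<ny. v i * v j * (\<integral>x. g i x y * g j x y * w x y \<partial>leb nx))"
    unfolding X_sq_eq using int_gg by (subst integral_double_sum) auto
  have EX: "?E X = (\<Sum>i<ny. v i * (\<integral>x. g i x y * w x y \<partial>leb nx))"
    unfolding X_eq using int_g by (subst Bochner_Integration.integral_sum) auto
  have EX_sq: "(?E X)\<^sup>2 = (\<Sum>i<ny. \<Sum>j<ny. v i * v j * ((\<integral>x. g i x y * w x y \<partial>leb nx) * (\<integral>x. g j x y * w x y \<partial>leb nx)))"
    unfolding EX by (simp add: power2_eq_square sum_product mult_ac)
  have hess: "(\<Sum>i<ny. \<Sum>j<ny. v i * v j * partial i (partial j (potential m)) y)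
      = ?E Q / m y - ?E (\<lambda>x. (X x)\<^sup>2) / m y + (?E X)\<^sup>2 / (m y)\<^sup>2"
    unfolding EQ EXX EX_sq sum_divide_distrib sum_subtractf[symmetric] sum.distrib[symmetric]
    by (intro sum.cong refl) (simp add: second_partial_potential_marg[OF y] algebra_simps)
  define a where "a = ?E X / m y"
  have "?E Q - ?E (\<lambda>x. (X x)\<^sup>2) = (\<integral>x. Q x * w x y - (X x)\<^sup>2 * w x y \<partial>leb nx)"
    using int_Q int_XX by simp
  also have "\<dots> \<le> (\<integral>x. (c * (\<Sum>i<ny. (v i)\<^sup>2) + a\<^sup>2) * w x y - 2 * a * (X x * w x y) \<partial>leb nx)"
  proof (rule integral_mono)
    show "integrable (leb nx) (\<lambda>x. (c * (\<Sum>i<ny. (v i)\<^sup>2) + a\<^sup>2) * w x y - 2 * a * (X x * w x y))"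
      using int_X slice_integrable[OF y] by simp
    fix x
    have "0 \<le> (X x - a)\<^sup>2" by simp
    then have "Q x - (X x)\<^sup>2 \<le> c * (\<Sum>i<ny. (v i)\<^sup>2) + a\<^sup>2 - 2 * a * X x"
      using hessian_slice_le[of v x y] by (simp add: Q_def power2_eq_square algebra_simps)
    from mult_right_mono[OF this, of "w x y"]
    show "Q x * w x y - (X x)\<^sup>2 * w x y \<le> (c * (\<Sum>i<ny. (v i)\<^sup>2) + a\<^sup>2) * w x y - 2 * a * (X x * w x y)"
      by (simp add: algebra_simps)
  qed (use int_Q int_XX in simp)
  also have "\<dots> = (c * (\<Sum>i<ny. (v i)\<^sup>2) + a\<^sup>2) * m y - 2 * a * ?E X"
    using int_X slice_integrable[OF y] by (simp add: marg_def)
  also have "\<dots> = (c * (\<Sum>i<ny. (v i)\<^sup>2) - a\<^sup>2) * m y"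
    using pos by (simp add: a_def field_simps power2_eq_square)
  finally have "(?E Q - ?E (\<lambda>x. (X x)\<^sup>2)) / m y \<le> c * (\<Sum>i<ny. (v i)\<^sup>2) - a\<^sup>2"
    using pos by (simp add: pos_divide_le_eq)
  then show "(\<Sum>i<ny. \<Sum>j<ny. v i * v j * partial i (partial j (potential m)) y) \<le> c * (\<Sum>i<ny. (v i)\<^sup>2)"
    unfolding hess by (simp add: a_def power_divide diff_divide_distrib)
qed

text \<open>
  Otherwise the second derivative of \<open>- ln m\<close> in coordinate 0 is nowhere positive, so every line integral
  of \<open>m\<close> in this direction is infinite, and by Fubini's theorem so is the integral of \<open>m\<close>.
\<close>

lemma smoothness_marg_pos:
  assumes ny: "1 \<le> ny"
  shows "0 < smoothness ny m"
proof (rule ccontr)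
  assume "\<not> 0 < smoothness ny m"
  then have zero: "smoothness ny m = 0" using smoothness_nonneg[of ny m] by auto
  have second: "partial 0 (partial 0 (potential m)) y \<le> 0" if y: "y \<in> euclid ny" for y
  proof (rule field_le_epsilon)
    fix e :: real assume "0 < e"
    then have "smoothness ny m < ereal e" using zero by simp
    then obtain b where b: "b < e" "hessian_le ny (potential m) y b"
      unfolding smoothness_def Inf_less_iff using y by auto
    have "partial 0 (partial 0 (potential m)) y \<le> b"
      using b(2)[unfolded hessian_le_def, rule_format, of "\<lambda>k. if k = 0 then 1 else 0"] ny
        sum_one_index(1)[of 0 ny "\<lambda>k l. partial k (partial l (potential m)) y"] sum_one_index(2)[of 0 ny]
      by simp
    then show "partial 0 (partial 0 (potential m)) y \<le> 0 + e" using b(1) by simp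
  qed
  have line: "(\<integral>\<^sup>+ t. ennreal (m (y(0 := t))) \<partial>lborel) = \<infinity>" if y: "y \<in> euclid ny" for y
  proof -
    have y': "y(0 := t) \<in> euclid ny" for t using upd_in_euclid[OF y] ny by simp
    have D: "((\<lambda>t. potential m (y(0 := t))) has_real_derivative partial 0 (potential m) (y(0 := t))) (at t)" for t
      using potential_marg_derivative[OF y, of 0 t] partial_potential_marg[OF y', of 0 t] ny by simp
    have DD: "((\<lambda>t. partial 0 (potential m) (y(0 := t))) has_real_derivative
        partial 0 (partial 0 (potential m)) (y(0 := t))) (at t)" for t
      using partial_potential_marg_derivative[OF y, of 0 0 t] second_partial_potential_marg[OF y', of 0 0 t] ny by simp
    have "partial 0 (potential m) (y(0 := t)) \<le> partial 0 (potential m) (y(0 := s))" if "s \<le> t" for s t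
      by (rule DERIV_nonpos_imp_nonincreasing[OF that]) (use DD second[OF y'] in blast)
    from log_convex_line_not_integrable[OF D this]
    show ?thesis using marg_pos[OF y'] by (simp add: potential_def)
  qed
  have ins: "{..<ny} = insert 0 {1..<ny}" using ny by auto
  have m_meas: "(\<lambda>y. ennreal (m y)) \<in> borel_measurable (Pi\<^sub>M (insert 0 {1..<ny}) (\<lambda>_. lborel))"
    using marg_measurable[OF density_V] by (simp add: leb_def ins)
  have "1 = (\<integral>\<^sup>+ y. ennreal (m y) \<partial>leb ny)"
    using prob_density_marg[OF density_V] by (simp add: prob_density_def)
  also have "\<dots> = (\<integral>\<^sup>+ y. \<integral>\<^sup>+ t. ennreal (m (y(0 := t))) \<partial>lborel \<partial>Pi\<^sub>M {1..<ny} (\<lambda>_. lborel))"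
    unfolding leb_def ins using m_meas by (subst lborel_product.product_nn_integral_insert) auto
  also have "\<dots> = (\<integral>\<^sup>+ y. \<infinity> \<partial>Pi\<^sub>M {1..<ny} (\<lambda>_. lborel :: real measure))"
  proof (rule nn_integral_cong)
    fix y :: point assume "y \<in> space (Pi\<^sub>M {1..<ny} (\<lambda>_. lborel :: real measure))"
    then have "y(0 := 0) \<in> euclid ny"
      using ny by (auto simp: space_PiM euclid_def PiE_iff extensional_def)
    from line[OF this] show "(\<integral>\<^sup>+ t. ennreal (m (y(0 := t))) \<partial>lborel) = \<infinity>" by simp
  qed
  also have "\<dots> = \<infinity>"
    using emeasure_PiM_lborel_pos[of "{1..<ny}" "space (Pi\<^sub>M {1..<ny} (\<lambda>_. lborel))" "\<lambda>_. 0"]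
    by (auto simp: space_PiM ennreal_top_mult)
  finally show False by simp
qed

end

section \<open>Comparison of the mixing time bounds\<close>

theorem theorem4p11:
  fixes nx ny :: nat
    and V_joint \<pi>_joint \<pi>_marg :: "point \<Rightarrow> real"
    and P0_joint P0_marg :: "point measure"
    and \<K> :: "'h kernel_family"
    and \<tau> :: "real \<Rightarrow> nat \<Rightarrow> real \<Rightarrow> real \<Rightarrow> real \<Rightarrow> 'h"
    and T :: "real \<Rightarrow> nat \<Rightarrow> real \<Rightarrow> real \<Rightarrow> real"
    and K_JointMH K_marg K_MarCo :: "real \<Rightarrow> point \<Rightarrow> point measure"
  assumes dims: "1 \<le> nx" "1 \<le> ny"
    and joint: "\<pi>_joint = (\<lambda>z. exp (- V_joint z))" "prob_density (nx + ny) \<pi>_joint"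
      "C2 (nx + ny) V_joint" "convex_fun (nx + ny) V_joint"
      "smoothness (nx + ny) \<pi>_joint < \<infinity>" "0 < isoper_const (nx + ny) \<pi>_joint"
    and marginal: "\<pi>_marg = marg nx ny \<pi>_joint"
    and MarCo: "\<And>\<epsilon> z. 0 < \<epsilon> \<Longrightarrow> z \<in> euclid (nx + ny) \<Longrightarrow>
      K_MarCo \<epsilon> z = cond_lift nx ny \<pi>_joint (K_marg \<epsilon> (ypart nx ny z))"
    and B1: "mh_family \<K>"
      "\<And>\<epsilon>. 0 < \<epsilon> \<Longrightarrow>
        K_JointMH \<epsilon> = \<K> (nx + ny) (tuned \<tau> \<epsilon> (nx + ny) P0_joint \<pi>_joint) \<pi>_joint"
      "\<And>\<epsilon>. 0 < \<epsilon> \<Longrightarrow> K_marg \<epsilon> = \<K> ny (tuned \<tau> \<epsilon> ny P0_marg \<pi>_marg) \<pi>_marg"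
    and B2: "prob_space P0_marg" "sets P0_marg = sets (leb ny)"
      "P0_joint = cond_lift nx ny \<pi>_joint P0_marg"
      "warm_start (nx + ny) P0_joint \<pi>_joint"
    and B3: "tuned_mixing_bound \<K> \<tau> T" "monotone_bound T"
  shows "\<forall>\<epsilon>>0. bound_at T \<epsilon> ny P0_marg \<pi>_marg < bound_at T \<epsilon> (nx + ny) P0_joint \<pi>_joint"
proof (intro allI impI)
  fix \<epsilon> :: real assume \<epsilon>: "0 < \<epsilon>"
  let ?d = "nx + ny"
  have dens: "prob_density ?d (\<lambda>z. exp (- V_joint z))" using joint(1,2) by simp
  have pot: "potential \<pi>_joint = V_joint" by (auto simp: potential_def joint(1))
  have marg_eq: "\<pi>_marg = marg nx ny (\<lambda>z. exp (- V_joint z))" using marginal joint(1) by simp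
  have smooth: "smooth_joint nx ny V_joint b"
    if "0 \<le> b" "\<forall>z\<in>euclid ?d. hessian_le ?d (potential \<pi>_joint) z b" for b
    using that(1) that(2)[unfolded pot] joint(3,4) dens by unfold_locales blast+
  obtain b where b: "0 \<le> b" "\<forall>z\<in>euclid ?d. hessian_le ?d (potential \<pi>_joint) z b"
    using joint(5) unfolding smoothness_def Inf_less_iff by auto
  interpret smooth_joint nx ny V_joint b by (rule smooth[OF b])

  let ?Lj = "smoothness ?d \<pi>_joint" and ?Lm = "smoothness ny \<pi>_marg"
  have L_pos: "0 < ?Lm" unfolding marg_eq by (rule smoothness_marg_pos[OF dims(2)])
  have L_le: "?Lm \<le> ?Lj"
    unfolding smoothness_def marg_eq
    using smooth_joint.hessian_le_marg[OF smooth] by (intro Inf_superset_mono) auto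
  have L: "0 < real_of_ereal ?Lm" "real_of_ereal ?Lm \<le> real_of_ereal ?Lj"
    using L_pos L_le joint(5) by (cases ?Lm; cases ?Lj; simp)+

  let ?Ij = "isoper_const ?d \<pi>_joint" and ?Im = "isoper_const ny \<pi>_marg"
  have I_le: "?Ij \<le> ?Im" unfolding marginal by (rule isoper_const_marg[OF joint(2)])
  have I_fin: "?Im < \<infinity>"
    unfolding marg_eq by (rule isoper_const_finite[OF dims(2) prob_density_marg[OF dens] marg_pos])
  have I: "0 < real_of_ereal ?Ij" "real_of_ereal ?Ij \<le> real_of_ereal ?Im"
    using I_le I_fin joint(6) by (cases ?Ij; cases ?Im; simp)+

  have \<kappa>: "0 < cond_number ny \<pi>_marg" "cond_number ny \<pi>_marg \<le> cond_number ?d \<pi>_joint"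
    unfolding cond_number_def using L I by (auto intro!: frac_le power_mono)

  let ?Bj = "warmness ?d P0_joint \<pi>_joint" and ?Bm = "warmness ny P0_marg \<pi>_marg"
  have warm: "warm_with ny P0_marg \<pi>_marg \<beta>" if "warm_with ?d P0_joint \<pi>_joint \<beta>" for \<beta>
    unfolding marg_eq
    using that by (intro warm_with_marg[OF dens slice_integrable marg_pos B2(1,2)]) (simp_all add: B2(3) joint(1))
  have B_le: "?Bm \<le> ?Bj"
    unfolding warmness_def using warm by (intro Inf_superset_mono) auto
  have B_fin: "?Bj < \<infinity>"
    using B2(4) unfolding warm_start_def warmness_def Inf_less_iff by auto
  have B_ge: "1 \<le> ?Bm"
    unfolding warmness_def by (rule Inf_greatest) (auto simp: warm_with_def one_ereal_def)
  have B: "1 \<le> real_of_ereal ?Bm" "real_of_ereal ?Bm \<le> real_of_ereal ?Bj"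
    using B_le B_fin B_ge by (cases ?Bm; cases ?Bj; simp)+

  have "bound_at T \<epsilon> ny P0_marg \<pi>_marg < T \<epsilon> ?d (real_of_ereal ?Bm) (cond_number ny \<pi>_marg)"
    using B3(2) \<epsilon> dims B(1) \<kappa>(1) unfolding bound_at_def monotone_bound_def
    by (auto intro!: strict_mono_onD[where A = "{1..}" and f = "\<lambda>d. T \<epsilon> d _ _"])
  also have "\<dots> \<le> T \<epsilon> ?d (real_of_ereal ?Bj) (cond_number ny \<pi>_marg)"
    using B3(2) \<epsilon> dims B \<kappa>(1) unfolding monotone_bound_def
    by (auto intro!: mono_onD[where A = "{1..}" and f = "\<lambda>\<beta>. T \<epsilon> ?d \<beta> _"])
  also have "\<dots> \<le> bound_at T \<epsilon> ?d P0_joint \<pi>_joint"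
    using B3(2) \<epsilon> dims B \<kappa> unfolding bound_at_def monotone_bound_def
    by (auto intro!: mono_onD[where A = "{0<..}" and f = "\<lambda>\<kappa>. T \<epsilon> ?d _ \<kappa>"])
  finally show "bound_at T \<epsilon> ny P0_marg \<pi>_marg < bound_at T \<epsilon> ?d P0_joint \<pi>_joint" .
qed

end
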